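(* Let $\mathcal{P}^+\subset\mathrm{Sym}^2(\mathbb{R}^n)$ be a closed convex cone (with vertex at the origin) satisfying the Positivity Condition. Consider the following two classes of closed subsets $Z$ of open sets $X\subset\mathbb{R}^n$: (1) closed subsets $Z\subset M$ of a $\mathcal{P}_+$-free closed submanifold $M\subset X$; (2) zero sets $Z=\{f=0\}$ of non-negative (smooth) strictly $\mathcal{P}^+$-plurisubharmonic functions $f$ on $X$. Locally these two classes are the same. That is, for a closed subset $Z$ of an open set $X\subset\mathbb{R}^n$, every point of $Z$ has an open neighborhood $U\subset X$ such that $Z\cap U$ belongs to class (1) (relative to $U$) if and only if every point of $Z$ has an open neighborhood $U\subset X$ such that $Z\cap U$ belongs to class (2) (relative to $U$).
   Context: $\mathrm{Sym}^2(\mathbb{R}^n)$ is the space of quadratic forms on $\mathbb{R}^n$ (real symmetric $n\times n$ matrices) with inner product $\langle A,B\rangle=\mathrm{tr}(AB)$, and $\mathcal{P}=\{A:A\ge0\}$. The polar of $\mathcal{P}^+$ is $\mathcal{P}_+=\{A:\langle A,B\rangle\ge0\ \forall B\in\mathcal{P}^+\}$. Positivity Condition: every $A\in\mathcal{P}_+$ is $\ge0$, equivalently $\mathcal{P}\subset\mathcal{P}^+$. For a linear subspace $W\subset\mathbb{R}^n$, $\mathrm{Sym}^2(W)$ is regarded as the subspace of $\mathrm{Sym}^2(\mathbb{R}^n)$ of those $A$ vanishing on $W^\perp$. A linear subspace $W\subset\mathbb{R}^n$ is $\mathcal{P}_+$-free if $\mathcal{P}_+\cap\mathrm{Sym}^2(W)=\{0\}$.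 A closed (smooth, embedded) submanifold $M$ of an open set $X\subset\mathbb{R}^n$ is $\mathcal{P}_+$-free if $T_xM$ is $\mathcal{P}_+$-free for every $x\in M$. A function $f\in C^\infty(X)$ is strictly $\mathcal{P}^+$-plurisubharmonic if $\mathrm{Hess}_xf\in\mathrm{Int}\,\mathcal{P}^+$ for every $x\in X$. *)

theory Defs
  imports "HOL-Analysis.Analysis"
begin

text \<open>Meaningful for open \<open>S\<close>: the derivatives are two-sided, so only the values of \<open>f\<close> on \<open>S\<close> matter.\<close>

primrec Ck_on :: "nat \<Rightarrow> 'a::euclidean_space set \<Rightarrow> ('a \<Rightarrow> 'b::real_normed_vector) \<Rightarrow> bool" where
  "Ck_on 0 S f \<longleftrightarrow> continuous_on S f"
| "Ck_on (Suc k) S f \<longleftrightarrow>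
     (\<forall>x\<in>S. f differentiable (at x)) \<and>
     (\<forall>v. Ck_on k S (\<lambda>x. frechet_derivative f (at x) v))"

definition smooth_on :: "'a::euclidean_space set \<Rightarrow> ('a \<Rightarrow> 'b::real_normed_vector) \<Rightarrow> bool" where
  "smooth_on S f \<longleftrightarrow> (\<forall>k. Ck_on k S f)"

definition partial_deriv :: "'n::finite \<Rightarrow> (real^'n \<Rightarrow> real) \<Rightarrow> real^'n \<Rightarrow> real" where
  "partial_deriv i f x = frechet_derivative f (at x) (axis i 1)"

definition Hess :: "(real^'n::finite \<Rightarrow> real) \<Rightarrow> real^'n \<Rightarrow> real^'n^'n" where
  "Hess f x = (\<chi> i j. partial_deriv i (partial_deriv j f) x)"

definition Sym2 :: "(real^'n::finite^'n) set" where
  "Sym2 = {A. transpose A = A}"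

definition psd_cone :: "(real^'n::finite^'n) set" where
  "psd_cone = {A \<in> Sym2. \<forall>v. 0 \<le> v \<bullet> (A *v v)}"

definition polar :: "(real^'n::finite^'n) set \<Rightarrow> (real^'n^'n) set" where
  "polar P = {A \<in> Sym2. \<forall>B\<in>P. 0 \<le> trace (A ** B)}"

definition positivity_condition :: "(real^'n::finite^'n) set \<Rightarrow> bool" where
  "positivity_condition P \<longleftrightarrow> polar P \<subseteq> psd_cone"

text \<open>A form in \<open>Sym2_sub W\<close> has \<open>W\<^sup>\<bottom>\<close> in its kernel, which is stronger than
  \<open>v \<bullet> (A *v v) = 0\<close> for \<open>v\<close> in \<open>W\<^sup>\<bottom>\<close>.\<close>

definition Sym2_sub :: "(real^'n::finite) set \<Rightarrow> (real^'n^'n) set" where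
  "Sym2_sub W = {A \<in> Sym2. \<forall>v \<in> orthogonal_comp W. A *v v = 0}"

definition free_subspace :: "(real^'n::finite^'n) set \<Rightarrow> (real^'n) set \<Rightarrow> bool" where
  "free_subspace P W \<longleftrightarrow> subspace W \<and> polar P \<inter> Sym2_sub W = {0}"

text \<open>The interior is taken in the space of symmetric matrices; as a set of \<open>n \<times> n\<close> matrices, \<open>P\<close>
  has empty interior as soon as \<open>n \<ge> 2\<close>.\<close>

definition strictly_psh_on ::
    "(real^'n::finite^'n) set \<Rightarrow> (real^'n) set \<Rightarrow> (real^'n \<Rightarrow> real) \<Rightarrow> bool" where
  "strictly_psh_on P X f \<longleftrightarrow>
     smooth_on X f \<and> (\<forall>x\<in>X. Hess f x \<in> (top_of_set Sym2) interior_of P)"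

definition diffeomorphism ::
    "'a::euclidean_space set \<Rightarrow> 'a set \<Rightarrow> ('a \<Rightarrow> 'a) \<Rightarrow> ('a \<Rightarrow> 'a) \<Rightarrow> bool" where
  "diffeomorphism U V \<phi> \<psi> \<longleftrightarrow>
     open U \<and> open V \<and> homeomorphism U V \<phi> \<psi> \<and> smooth_on U \<phi> \<and> smooth_on V \<psi>"

text \<open>Slice charts: near each of its points \<open>M\<close> is straightened to a \<open>k\<close>-dimensional linear subspace.
  The empty set is a submanifold of every dimension.\<close>

definition closed_submanifold :: "nat \<Rightarrow> 'a::euclidean_space set \<Rightarrow> 'a set \<Rightarrow> bool" where
  "closed_submanifold k X M \<longleftrightarrow>
     closedin (top_of_set X) M \<and>
     (\<forall>x\<in>M. \<exists>U V \<phi> \<psi> L. x \<in> U \<and> U \<subseteq> X \<and> diffeomorphism U V \<phi> \<psi> \<and>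
        subspace L \<and> dim L = k \<and> \<phi> ` (M \<inter> U) = V \<inter> L)"

definition tangent_space :: "'a::euclidean_space set \<Rightarrow> 'a \<Rightarrow> 'a set" where
  "tangent_space M x =
     {v. \<exists>\<gamma> \<epsilon>. 0 < \<epsilon> \<and> smooth_on {-\<epsilon><..<\<epsilon>} \<gamma> \<and> \<gamma> ` {-\<epsilon><..<\<epsilon>} \<subseteq> M \<and> \<gamma> 0 = x \<and>
        (\<gamma> has_vector_derivative v) (at (0::real))}"

definition free_closed_submanifold ::
    "(real^'n::finite^'n) set \<Rightarrow> (real^'n) set \<Rightarrow> (real^'n) set \<Rightarrow> bool" where
  "free_closed_submanifold P X M \<longleftrightarrow>
     (\<exists>k. closed_submanifold k X M) \<and> (\<forall>x\<in>M. free_subspace P (tangent_space M x))"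

definition subset_of_free_submanifold ::
    "(real^'n::finite^'n) set \<Rightarrow> (real^'n) set \<Rightarrow> (real^'n) set \<Rightarrow> bool" where
  "subset_of_free_submanifold P X Z \<longleftrightarrow>
     closedin (top_of_set X) Z \<and> (\<exists>M. free_closed_submanifold P X M \<and> Z \<subseteq> M)"

definition zero_set_of_strictly_psh ::
    "(real^'n::finite^'n) set \<Rightarrow> (real^'n) set \<Rightarrow> (real^'n) set \<Rightarrow> bool" where
  "zero_set_of_strictly_psh P X Z \<longleftrightarrow>
     (\<exists>f. strictly_psh_on P X f \<and> (\<forall>x\<in>X. 0 \<le> f x) \<and> Z = {x\<in>X. f x = 0})"

end

theory Submission
  imports Defs
begin

text \<open>Write \<open>\<langle>A, B\<rangle> = tr (A B)\<close>. Both implications rest on one duality: a symmetric \<open>B\<close> is interior to \<open>P\<close>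
exactly when \<open>\<langle>A, B\<rangle> > 0\<close> for all nonzero \<open>A\<close> in the polar. One direction perturbs \<open>B\<close> to
\<open>B - t A\<close>; the other uses that \<open>P\<close> is its own bipolar and that the unit vectors of the polar form
a compact set (\<open>polar_zero_on_interior\<close>, \<open>interior_of_cone_if_positive_on_polar\<close>). The Positivity
Condition enters by making each such \<open>A\<close> positive semidefinite, so that \<open>\<langle>A, \<Sum> r r\<^sup>T\<rangle> = \<Sum> r \<bullet> A r\<close>
vanishes only if \<open>A\<close> kills every \<open>r\<close>.

\<^emph>\<open>From a function to a submanifold\<close> (\<open>zero_set_locally_in_free_submanifold\<close>). Let \<open>f z = 0\<close> and
let \<open>H\<close> be the Hessian of \<open>f\<close> at \<open>z\<close>. The zeros of \<open>f\<close> are minima, hence critical points, so they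
lie in \<open>M = {Q grad f = 0}\<close>, where \<open>Q\<close> is the orthogonal projection with kernel \<open>ker H\<close>. Since
\<open>Q H = H\<close> is onto the range of \<open>Q\<close>, these equations are independent at \<open>z\<close>, and \<open>M\<close> is a
submanifold near \<open>z\<close>, with tangent space \<open>ker (Q Hess f x)\<close> at \<open>x\<close>. A form in the polar carried by
that tangent space is orthogonal to the symmetrization of \<open>Q Hess f x\<close>. This symmetrization equals
\<open>H\<close> at \<open>z\<close>, so it is interior to \<open>P\<close> for \<open>x\<close> near \<open>z\<close>, and the form must be \<open>0\<close>.

\<^emph>\<open>From a submanifold to a function\<close> (\<open>subset_of_free_submanifold_locally_zero_set\<close>). Straighten
\<open>M\<close> near \<open>z\<close> by a chart \<open>\<phi>\<close> onto a linear subspace \<open>L\<close>, let \<open>Q\<close> be the orthogonal projection with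
kernel \<open>L\<close>, and let \<open>w\<close> be a smooth function whose zero set is the complement of an open set \<open>W\<close>.
Then \<open>f = |Q \<phi>|\<^sup>2 + w\<^sup>2\<close> vanishes exactly on \<open>M - W\<close>. At a zero, the Hessian of \<open>f\<close> is twice a sum
of squares of gradients, and a form in the polar that is orthogonal to it is carried by the tangent
space; so freeness makes it interior to \<open>P\<close>, at \<open>z\<close> and hence nearby.

The analysis behind this is a calculus of smooth functions, the inverse function theorem with
smooth inverse, the symmetry of second derivatives, and Whitney's theorem that every closed set is
the zero set of a smooth function.\<close>

section \<open>A calculus of smooth functions\<close>

text \<open>The direction comes before the point, so that \<open>dderiv f v\<close> is again a function that can be
differentiated.\<close>

abbreviation dderiv :: "('a::euclidean_space \<Rightarrow> 'b::real_normed_vector) \<Rightarrow> 'a \<Rightarrow> 'a \<Rightarrow> 'b" where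
  "dderiv f v \<equiv> (\<lambda>x. frechet_derivative f (at x) v)"

lemma frechet_derivative_eqI:
  "(f has_derivative f') (at x) \<Longrightarrow> frechet_derivative f (at x) = f'"
  by (rule frechet_derivative_at[symmetric])

lemma frechet_derivative_cong_open:
  assumes "open S" "x \<in> S" "\<And>y. y \<in> S \<Longrightarrow> f y = g y"
  shows "frechet_derivative f (at x) = frechet_derivative g (at x)"
proof -
  have "(f has_derivative f') (at x) \<longleftrightarrow> (g has_derivative f') (at x)" for f'
    using has_derivative_transform_within_open[OF _ assms(1,2)] assms(3) by metis
  then show ?thesis
    unfolding frechet_derivative_def by simp
qed

lemma Ck_on_cong:
  assumes "open S" "\<And>x. x \<in> S \<Longrightarrow> f x = g x" "Ck_on k S f"
  shows "Ck_on k S g"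
  using assms(2,3)
proof (induction k arbitrary: f g)
  case 0
  then show ?case by (simp cong: continuous_on_cong)
next
  case (Suc k)
  have "g differentiable (at x)" if "x \<in> S" for x
    using that Suc.prems assms(1)
    by (metis Ck_on.simps(2) differentiable_def has_derivative_transform_within_open)
  moreover have "Ck_on k S (dderiv g v)" for v
    by (rule Suc.IH[of "dderiv f v"])
       (use Suc.prems frechet_derivative_cong_open[OF assms(1)] in \<open>auto, metis\<close>)
  ultimately show ?case by simp
qed

lemma Ck_on_mono: "Ck_on k S f \<Longrightarrow> T \<subseteq> S \<Longrightarrow> Ck_on k T f"
  by (induction k arbitrary: f) (auto intro: continuous_on_subset)

lemma Ck_on_SucD: "Ck_on (Suc k) S f \<Longrightarrow> Ck_on k S f"
proof (induction k arbitrary: f)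
  case 0
  then show ?case
    by (auto intro!: continuous_at_imp_continuous_on differentiable_imp_continuous_within)
next
  case (Suc k)
  then show ?case by (metis Ck_on.simps(2))
qed

text \<open>The form in which higher regularity is proved throughout: any formula for the derivative may stand
in for the Frechet derivative, which depends only on the values of \<open>f\<close> near the point.\<close>

lemma Ck_on_SucI:
  assumes "open S" "\<And>x. x \<in> S \<Longrightarrow> (f has_derivative f' x) (at x)"
    and "\<And>v. Ck_on k S (\<lambda>x. f' x v)"
  shows "Ck_on (Suc k) S f"
proof -
  have "Ck_on k S (dderiv f v)" for v
    by (rule Ck_on_cong[OF assms(1) _ assms(3)]) (simp add: frechet_derivative_eqI[OF assms(2)])
  then show ?thesis
    using assms(2) by (auto simp: differentiable_def)
qed

lemma has_derivative_dderiv: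
  assumes "Ck_on (Suc k) S f" "x \<in> S"
  shows "(f has_derivative (\<lambda>v. dderiv f v x)) (at x)"
  using assms by (simp add: frechet_derivative_works)

lemma Ck_on_const: "open S \<Longrightarrow> Ck_on k S (\<lambda>x. c)"
proof (induction k arbitrary: c)
  case (Suc k)
  then show ?case by (intro Ck_on_SucI[where f' = "\<lambda>x v. 0"]) auto
qed simp

lemma Ck_on_bounded_linear:
  assumes "open S" "bounded_linear h"
  shows "Ck_on k S f \<Longrightarrow> Ck_on k S (\<lambda>x. h (f x))"
proof (induction k arbitrary: f)
  case 0
  then show ?case using bounded_linear.continuous_on[OF assms(2)] by simp
next
  case (Suc k)
  show ?case
  proof (rule Ck_on_SucI[OF assms(1), where f' = "\<lambda>x v. h (dderiv f v x)"])
    show "((\<lambda>x. h (f x)) has_derivative (\<lambda>v. h (dderiv f v x))) (at x)" if "x \<in> S" for x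
      by (rule bounded_linear.has_derivative[OF assms(2) has_derivative_dderiv[OF Suc.prems that]])
    show "Ck_on k S (\<lambda>x. h (dderiv f v x))" for v
      using Suc by simp
  qed
qed

lemma Ck_on_id: "open S \<Longrightarrow> Ck_on k S (\<lambda>x. x)"
  by (cases k) (auto intro!: Ck_on_SucI[where f' = "\<lambda>x v. v"] Ck_on_const)

lemma Ck_on_add:
  assumes "open S"
  shows "Ck_on k S f \<Longrightarrow> Ck_on k S g \<Longrightarrow> Ck_on k S (\<lambda>x. f x + g x)"
proof (induction k arbitrary: f g)
  case (Suc k)
  show ?case
  proof (rule Ck_on_SucI[OF assms(1), where f' = "\<lambda>x v. dderiv f v x + dderiv g v x"])
    show "((\<lambda>x. f x + g x) has_derivative (\<lambda>v. dderiv f v x + dderiv g v x)) (at x)"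
      if "x \<in> S" for x
      by (intro has_derivative_add Suc.prems[THEN has_derivative_dderiv] that)
    show "Ck_on k S (\<lambda>x. dderiv f v x + dderiv g v x)" for v
      using Suc by simp
  qed
qed (auto intro: continuous_intros)

lemma Ck_on_bilinear:
  assumes "open S" "bounded_bilinear h"
  shows "Ck_on k S f \<Longrightarrow> Ck_on k S g \<Longrightarrow> Ck_on k S (\<lambda>x. h (f x) (g x))"
proof (induction k arbitrary: f g)
  case 0
  then show ?case using bounded_bilinear.continuous_on[OF assms(2)] by simp
next
  case (Suc k)
  have "Ck_on k S (dderiv f v)" "Ck_on k S (dderiv g v)" for v
    using Suc.prems by simp_all
  then have "Ck_on k S (\<lambda>x. h (f x) (dderiv g v x) + h (dderiv f v x) (g x))" for v
    by (intro Ck_on_add Suc.IH assms Suc.prems[THEN Ck_on_SucD])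
  moreover have "((\<lambda>x. h (f x) (g x)) has_derivative (\<lambda>v. h (f x) (dderiv g v x) + h (dderiv f v x) (g x))) (at x)"
    if "x \<in> S" for x
    by (intro bounded_bilinear.FDERIV[OF assms(2)] Suc.prems[THEN has_derivative_dderiv] that)
  ultimately show ?case
    by (intro Ck_on_SucI[OF assms(1)])
qed

lemma Ck_on_sum:
  assumes "open S" "\<And>i. i \<in> I \<Longrightarrow> Ck_on k S (f i)"
  shows "Ck_on k S (\<lambda>x. \<Sum>i\<in>I. f i x)"
  using assms(2)
  by (induction I rule: infinite_finite_induct) (auto intro: Ck_on_const Ck_on_add assms(1))

text \<open>The derivative of \<open>1 / f\<close> is a product of copies of \<open>1 / f\<close> and a derivative of \<open>f\<close>, so one more
derivative of \<open>1 / f\<close> costs nothing but one more derivative of \<open>f\<close>.\<close>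

lemma Ck_on_inverse:
  fixes f :: "'a::euclidean_space \<Rightarrow> real"
  assumes "open S" "\<And>x. x \<in> S \<Longrightarrow> f x \<noteq> 0"
  shows "Ck_on k S f \<Longrightarrow> Ck_on k S (\<lambda>x. inverse (f x))"
proof (induction k)
  case 0
  then show ?case using assms(2) by (auto intro: continuous_intros)
next
  case (Suc k)
  have 1: "Ck_on k S (\<lambda>x. inverse (f x))" "\<And>v. Ck_on k S (dderiv f v)"
    using Suc Ck_on_SucD by auto
  have "Ck_on k S (\<lambda>x. - (inverse (f x) * dderiv f v x * inverse (f x)))" for v
    by (intro Ck_on_bounded_linear[OF assms(1), OF bounded_linear_minus[OF bounded_linear_ident]] Ck_on_bilinear[OF assms(1) bounded_bilinear_mult] 1)
  moreover have "((\<lambda>x. inverse (f x)) has_derivative (\<lambda>v. - (inverse (f x) * dderiv f v x * inverse (f x)))) (at x)"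
    if "x \<in> S" for x
    by (rule Deriv.has_derivative_inverse[OF assms(2)[OF that] has_derivative_dderiv[OF Suc.prems that]])
  ultimately show ?case
    by (intro Ck_on_SucI[OF assms(1)])
qed

text \<open>Unlike the single levels \<open>Ck_on k\<close>, smoothness is preserved by differentiation; this is what lets
the inductions below treat a function and its derivatives alike.\<close>

lemma smooth_on_Suc: "smooth_on S f \<longleftrightarrow> (\<forall>x\<in>S. f differentiable (at x)) \<and> (\<forall>v. smooth_on S (dderiv f v))"
proof
  assume "smooth_on S f"
  then have "Ck_on (Suc k) S f" for k by (simp only: smooth_on_def)
  then show "(\<forall>x\<in>S. f differentiable (at x)) \<and> (\<forall>v. smooth_on S (dderiv f v))"
    by (auto simp: smooth_on_def)
next
  assume "(\<forall>x\<in>S. f differentiable (at x)) \<and> (\<forall>v. smooth_on S (dderiv f v))"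
  then have "Ck_on (Suc k) S f" for k
    by (auto simp: smooth_on_def)
  then show "smooth_on S f"
    unfolding smooth_on_def using Ck_on_SucD by blast
qed

lemma smooth_on_dderiv: "smooth_on S f \<Longrightarrow> smooth_on S (dderiv f v)"
  using smooth_on_Suc by blast

lemma smooth_on_differentiable: "smooth_on S f \<Longrightarrow> x \<in> S \<Longrightarrow> f differentiable (at x)"
  using smooth_on_Suc by blast

lemma smooth_on_has_derivative:
  "smooth_on S f \<Longrightarrow> x \<in> S \<Longrightarrow> (f has_derivative (\<lambda>v. dderiv f v x)) (at x)"
  using has_derivative_dderiv smooth_on_def by blast

lemma smooth_on_continuous_on: "smooth_on S f \<Longrightarrow> continuous_on S f"
  unfolding smooth_on_def by (metis Ck_on.simps(1))

lemma smooth_on_mono: "smooth_on S f \<Longrightarrow> T \<subseteq> S \<Longrightarrow> smooth_on T f"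
  unfolding smooth_on_def using Ck_on_mono by blast

lemma smooth_on_cong: "open S \<Longrightarrow> (\<And>x. x \<in> S \<Longrightarrow> f x = g x) \<Longrightarrow> smooth_on S f \<Longrightarrow> smooth_on S g"
  unfolding smooth_on_def using Ck_on_cong by blast

lemma smooth_on_const: "open S \<Longrightarrow> smooth_on S (\<lambda>x. c)"
  by (simp add: smooth_on_def Ck_on_const)

lemma smooth_on_id: "open S \<Longrightarrow> smooth_on S (\<lambda>x. x)"
  by (simp add: smooth_on_def Ck_on_id)

lemma smooth_on_add:
  "open S \<Longrightarrow> smooth_on S f \<Longrightarrow> smooth_on S g \<Longrightarrow> smooth_on S (\<lambda>x. f x + g x)"
  by (simp add: smooth_on_def Ck_on_add)

lemma smooth_on_bounded_linear:
  "open S \<Longrightarrow> bounded_linear h \<Longrightarrow> smooth_on S f \<Longrightarrow> smooth_on S (\<lambda>x. h (f x))"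
  by (simp add: smooth_on_def Ck_on_bounded_linear)

lemma smooth_on_bilinear:
  "open S \<Longrightarrow> bounded_bilinear h \<Longrightarrow> smooth_on S f \<Longrightarrow> smooth_on S g \<Longrightarrow>
    smooth_on S (\<lambda>x. h (f x) (g x))"
  by (simp add: smooth_on_def Ck_on_bilinear)

lemma smooth_on_sum:
  "open S \<Longrightarrow> (\<And>i. i \<in> I \<Longrightarrow> smooth_on S (f i)) \<Longrightarrow> smooth_on S (\<lambda>x. \<Sum>i\<in>I. f i x)"
  by (simp add: smooth_on_def Ck_on_sum)

lemma smooth_on_inverse:
  fixes f :: "'a::euclidean_space \<Rightarrow> real"
  shows "open S \<Longrightarrow> (\<And>x. x \<in> S \<Longrightarrow> f x \<noteq> 0) \<Longrightarrow> smooth_on S f \<Longrightarrow> smooth_on S (\<lambda>x. inverse (f x))"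
  by (simp add: smooth_on_def Ck_on_inverse)

lemma smooth_on_mult:
  fixes f g :: "'a::euclidean_space \<Rightarrow> real"
  shows "open S \<Longrightarrow> smooth_on S f \<Longrightarrow> smooth_on S g \<Longrightarrow> smooth_on S (\<lambda>x. f x * g x)"
  by (rule smooth_on_bilinear[OF _ bounded_bilinear_mult])

lemma smooth_on_prod:
  fixes F :: "'i \<Rightarrow> 'a::euclidean_space \<Rightarrow> real"
  assumes "open S" "\<And>i. i \<in> I \<Longrightarrow> smooth_on S (F i)"
  shows "smooth_on S (\<lambda>x. \<Prod>i\<in>I. F i x)"
  using assms(2)
  by (induction I rule: infinite_finite_induct)
     (auto intro: smooth_on_const smooth_on_mult assms(1))

lemma smooth_on_vec_nth: "open S \<Longrightarrow> smooth_on S f \<Longrightarrow> smooth_on S (\<lambda>x. f x $ i)"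
  for f :: "'a::euclidean_space \<Rightarrow> real^'n::finite"
  by (rule smooth_on_bounded_linear[OF _ bounded_linear_vec_nth])

lemma smooth_on_vec_lambda:
  fixes f :: "'n::finite \<Rightarrow> 'a::euclidean_space \<Rightarrow> real"
  assumes "open S" "\<And>i. smooth_on S (f i)"
  shows "smooth_on S (\<lambda>x. \<chi> i. f i x)"
proof -
  have "(\<chi> i. f i x) = (\<Sum>i\<in>UNIV. f i x *\<^sub>R axis i 1)" for x
    by (simp add: vec_eq_iff axis_def if_distrib cong: if_cong)
  then show ?thesis
    using assms by (auto intro!: smooth_on_sum smooth_on_bilinear[OF _ bounded_bilinear_scaleR] smooth_on_const)
qed

lemma smooth_on_det:
  fixes A :: "'a::euclidean_space \<Rightarrow> real^'n::finite^'n"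
  assumes "open S" "\<And>i j. smooth_on S (\<lambda>x. A x $ i $ j)"
  shows "smooth_on S (\<lambda>x. det (A x))"
  unfolding det_def
  by (intro smooth_on_sum smooth_on_mult smooth_on_prod smooth_on_const assms)

section \<open>The inverse function theorem with smooth inverse\<close>

lemma frechet_derivative_linear_sum:
  fixes f :: "'a::euclidean_space \<Rightarrow> 'b::real_normed_vector"
  assumes "f differentiable (at x)"
  shows "dderiv f u x = (\<Sum>b\<in>Basis. (u \<bullet> b) *\<^sub>R dderiv f b x)"
proof -
  interpret D: linear "frechet_derivative f (at x)"
    by (rule linear_frechet_derivative[OF assms])
  have "dderiv f u x = dderiv f (\<Sum>b\<in>Basis. (u \<bullet> b) *\<^sub>R b) x"
    by (simp add: euclidean_representation)
  then show ?thesis by (simp add: D.sum D.scale)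
qed

text \<open>By Cramer's rule, the inverse of the derivative applied to a vector is a quotient of determinants,
hence a rational expression in partial derivatives of \<open>\<phi>\<close>.\<close>

lemma smooth_on_inverse_derivative:
  fixes \<phi> :: "real^'n::finite \<Rightarrow> real^'n"
  assumes "open U" "smooth_on U \<phi>" and bij: "\<And>x. x \<in> U \<Longrightarrow> bij (frechet_derivative \<phi> (at x))"
  shows "smooth_on U (\<lambda>x. inv (frechet_derivative \<phi> (at x)) v)"
proof -
  define A where "A x = matrix (frechet_derivative \<phi> (at x))" for x
  have A: "A x *v w = dderiv \<phi> w x" if "x \<in> U" for x w
    unfolding A_def
    by (intro matrix_works)
       (simp add: linear_matrix_vector_mul_eq linear_frechet_derivative[OF smooth_on_differentiable[OF assms(2) that]])
  have detA: "det (A x) \<noteq> 0" if "x \<in> U" for x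
  proof -
    have "inj ((*v) (A x))"
      using bij[OF that] A[OF that] by (simp add: bij_def inj_def)
    then show ?thesis
      by (simp add: invertible_det_nz[symmetric] invertible_left_inverse matrix_left_invertible_injective)
  qed
  have smA: "smooth_on U (\<lambda>x. A x $ i $ j)" for i j
    unfolding A_def matrix_def using smooth_on_vec_nth[OF assms(1) smooth_on_dderiv[OF assms(2)]]
    by simp
  have smAv: "smooth_on U (\<lambda>x. if j = k then v $ i else A x $ i $ j)" for i j k
    by (cases "j = k") (simp_all add: smA smooth_on_const assms(1))
  define J where "J x = (\<chi> k. det (\<chi> i j. if j = k then v $ i else A x $ i $ j) * inverse (det (A x)))" for x
  have sm: "smooth_on U J"
    unfolding J_def
    by (intro smooth_on_vec_lambda smooth_on_mult smooth_on_inverse smooth_on_det assms(1) detA)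
       (simp_all add: smA smAv)
  have J: "J x = inv (frechet_derivative \<phi> (at x)) v" if "x \<in> U" for x
  proof -
    have "A x *v J x = v"
      using cramer[OF detA[OF that], of "J x" v] unfolding J_def by (simp add: divide_inverse)
    then have "frechet_derivative \<phi> (at x) (J x) = v"
      using A[OF that] by simp
    then show ?thesis
      using bij[OF that] by (metis bij_inv_eq_iff)
  qed
  show ?thesis
    by (rule smooth_on_cong[OF assms(1) J sm])
qed

text \<open>The functions \<open>h \<circ> \<psi>\<close> with \<open>h\<close> smooth are closed under differentiation: a directional derivative of
\<open>h \<circ> \<psi>\<close> is \<open>m \<circ> \<psi>\<close>, where \<open>m x\<close> differentiates \<open>h\<close> at \<open>x\<close> along the preimage of the direction under
the derivative of \<open>\<phi>\<close>. Induction over this whole family avoids a higher-order chain rule.\<close>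

lemma smooth_on_inverse_function:
  fixes \<phi> \<psi> :: "real^'n::finite \<Rightarrow> real^'n"
  assumes U: "open U" and V: "open V" and \<phi>: "smooth_on U \<phi>"
    and bij: "\<And>x. x \<in> U \<Longrightarrow> bij (frechet_derivative \<phi> (at x))"
    and \<psi>: "\<And>y. y \<in> V \<Longrightarrow> \<psi> y \<in> U"
    and der: "\<And>y. y \<in> V \<Longrightarrow> (\<psi> has_derivative inv (frechet_derivative \<phi> (at (\<psi> y)))) (at y)"
  shows "smooth_on V \<psi>"
proof -
  have "Ck_on k V (\<lambda>y. h (\<psi> y))" if "smooth_on U h" for k and h :: "real^'n \<Rightarrow> real^'n"
    using that
  proof (induction k arbitrary: h)
    case 0
    have "continuous_on V \<psi>"
      using der by (meson V continuous_on_eq_continuous_at has_derivative_continuous)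
    then show ?case
      using smooth_on_continuous_on[OF 0] \<psi>
      by (auto intro: continuous_on_compose2)
  next
    case (Suc k)
    define J where "J x = inv (frechet_derivative \<phi> (at x))" for x
    have "((\<lambda>y. h (\<psi> y)) has_derivative (\<lambda>v. dderiv h (J (\<psi> y) v) (\<psi> y))) (at y)" if "y \<in> V" for y
      using has_derivative_compose[OF der[OF that] smooth_on_has_derivative[OF Suc.prems \<psi>[OF that]]]
      by (simp add: J_def)
    moreover have "Ck_on k V (\<lambda>y. dderiv h (J (\<psi> y) v) (\<psi> y))" for v
    proof (rule Suc.IH)
      have "smooth_on U (\<lambda>x. J x v)"
        unfolding J_def by (rule smooth_on_inverse_derivative[OF U \<phi> bij])
      then have sm: "smooth_on U (\<lambda>x. \<Sum>b\<in>Basis. (J x v \<bullet> b) *\<^sub>R dderiv h b x)"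
        by (intro smooth_on_sum smooth_on_bilinear[OF U bounded_bilinear_scaleR] U
              smooth_on_bounded_linear[OF U bounded_linear_inner_left] smooth_on_dderiv Suc.prems)
      show "smooth_on U (\<lambda>x. dderiv h (J x v) x)"
        by (rule smooth_on_cong[OF U _ sm])
           (rule frechet_derivative_linear_sum[OF smooth_on_differentiable[OF Suc.prems], symmetric])
    qed
    ultimately show ?case
      by (rule Ck_on_SucI[OF V])
  qed
  from this[OF smooth_on_id[OF U]] show ?thesis
    by (simp add: smooth_on_def)
qed

lemma smooth_inverse_function_theorem:
  fixes \<phi> :: "real^'n::finite \<Rightarrow> real^'n"
  assumes S: "open S" "z \<in> S" and \<phi>: "smooth_on S \<phi>" and inj: "inj (frechet_derivative \<phi> (at z))"
  obtains U V \<psi> where "z \<in> U" "U \<subseteq> S" "diffeomorphism U V \<phi> \<psi>"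
proof -
  define D where "D x = Blinfun (frechet_derivative \<phi> (at x))" for x
  have D: "blinfun_apply (D x) = frechet_derivative \<phi> (at x)" if "x \<in> S" for x
    unfolding D_def
    by (rule bounded_linear_Blinfun_apply[OF has_derivative_bounded_linear[OF smooth_on_has_derivative[OF \<phi> that]]])
  have der: "(\<phi> has_derivative blinfun_apply (D x)) (at x)" if "x \<in> S" for x
    using smooth_on_has_derivative[OF \<phi> that] by (simp add: D[OF that])
  have cont: "continuous_on S D"
    by (rule continuous_on_blinfun_componentwise)
       (use D smooth_on_continuous_on[OF smooth_on_dderiv[OF \<phi>]] in \<open>simp cong: continuous_on_cong\<close>)
  obtain g where g: "linear g" "g \<circ> frechet_derivative \<phi> (at z) = id"
    using linear_injective_left_inverse[OF _ inj] has_derivative_linear[OF der[OF S(2)]] D[OF S(2)] by auto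
  have inv: "Blinfun g o\<^sub>L D z = id_blinfun"
    using g by (intro blinfun_eqI) (simp add: bounded_linear_Blinfun_apply linear_conv_bounded_linear D[OF S(2)] pointfree_idE)
  obtain U V \<psi> g' where *: "homeomorphism U V \<phi> \<psi>"
    "\<And>y. y \<in> V \<Longrightarrow> (\<psi> has_derivative (g' y)) (at y)"
    "\<And>y. y \<in> V \<Longrightarrow> g' y = inv (blinfun_apply (D (\<psi> y)))"
    "\<And>y. y \<in> V \<Longrightarrow> bij (blinfun_apply (D (\<psi> y)))"
    "U \<subseteq> S" "z \<in> U" "open U" "open V"
    by (rule inverse_function_theorem[OF S(1) _ cont S(2) inv], erule der, rule that)
  have \<psi>: "\<psi> y \<in> U" if "y \<in> V" for y
    using *(1) that by (auto simp: homeomorphism_def)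
  have "smooth_on U \<phi>"
    using \<phi> *(5) smooth_on_mono by blast
  moreover have "smooth_on V \<psi>"
  proof (rule smooth_on_inverse_function[OF *(7,8) \<open>smooth_on U \<phi>\<close> _ \<psi>])
    show "bij (frechet_derivative \<phi> (at x))" if "x \<in> U" for x
      using *(4)[of "\<phi> x"] *(1,5) that D[of x] by (auto simp: homeomorphism_def)
    show "(\<psi> has_derivative inv (frechet_derivative \<phi> (at (\<psi> y)))) (at y)" if "y \<in> V" for y
      using *(2,3)[OF that] *(5) \<psi>[OF that] D[of "\<psi> y"] by auto
  qed
  ultimately show ?thesis
    using that[of U V \<psi>] * by (simp add: diffeomorphism_def)
qed

section \<open>Symmetry of second derivatives\<close>

lemma has_derivative_along_line:
  assumes "(f has_derivative D) (at (c + r *\<^sub>R a))"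
  shows "((\<lambda>r. f (c + r *\<^sub>R a)) has_derivative (\<lambda>h. h *\<^sub>R D a)) (at r)"
proof -
  have "((\<lambda>r. c + r *\<^sub>R a) has_derivative (\<lambda>h. h *\<^sub>R a)) (at r)"
    by (auto intro!: derivative_eq_intros)
  from has_derivative_compose[OF this assms] show ?thesis
    using has_derivative_linear[OF assms] by (simp add: linear_cmul)
qed

text \<open>Two applications of the mean value theorem turn the second difference of \<open>f\<close> over a small
parallelogram into \<open>t\<^sup>2\<close> times a mixed derivative at a nearby point, in either order. If the two
mixed derivatives differed at \<open>x\<close>, continuity would keep them apart at nearby points as well.\<close>

lemma second_derivative_symmetric:
  fixes f :: "'a::euclidean_space \<Rightarrow> real"
  assumes S: "open S" "x \<in> S" and f: "smooth_on S f"
  shows "dderiv (dderiv f u) v x = dderiv (dderiv f v) u x"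
proof (rule ccontr)
  define d where "d = \<bar>dderiv (dderiv f u) v x - dderiv (dderiv f v) u x\<bar> / 2"
  assume "dderiv (dderiv f u) v x \<noteq> dderiv (dderiv f v) u x"
  then have "d > 0" by (simp add: d_def)
  have near: "\<exists>e>0. \<forall>y. norm (y - x) < e \<longrightarrow> y \<in> S \<and> \<bar>dderiv (dderiv f a) b y - dderiv (dderiv f a) b x\<bar> < d"
    for a b
  proof -
    have "continuous (at x) (dderiv (dderiv f a) b)"
      using smooth_on_continuous_on[OF smooth_on_dderiv[OF smooth_on_dderiv[OF f]]] S
      by (meson continuous_on_eq_continuous_at)
    then obtain e1 where "e1 > 0" "\<And>y. dist y x < e1 \<Longrightarrow> dist (dderiv (dderiv f a) b y) (dderiv (dderiv f a) b x) < d"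
      using \<open>d > 0\<close> unfolding continuous_at_eps_delta by (metis dist_commute)
    moreover obtain e2 where "e2 > 0" "\<And>y. dist y x < e2 \<Longrightarrow> y \<in> S"
      using S open_dist by blast
    ultimately show ?thesis
      by (intro exI[of _ "min e1 e2"]) (auto simp: dist_norm)
  qed
  obtain e where e: "e > 0" "\<And>y. norm (y - x) < e \<Longrightarrow> y \<in> S"
    "\<And>y. norm (y - x) < e \<Longrightarrow> \<bar>dderiv (dderiv f u) v y - dderiv (dderiv f u) v x\<bar> < d"
    "\<And>y. norm (y - x) < e \<Longrightarrow> \<bar>dderiv (dderiv f v) u y - dderiv (dderiv f v) u x\<bar> < d"
  proof -
    obtain e1 e2 where "e1 > 0" "e2 > 0"
      "\<forall>y. norm (y - x) < e1 \<longrightarrow> y \<in> S \<and> \<bar>dderiv (dderiv f u) v y - dderiv (dderiv f u) v x\<bar> < d"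
      "\<forall>y. norm (y - x) < e2 \<longrightarrow> y \<in> S \<and> \<bar>dderiv (dderiv f v) u y - dderiv (dderiv f v) u x\<bar> < d"
      using near by metis
    then show ?thesis
      by (intro that[of "min e1 e2"]) auto
  qed
  \<comment> \<open>Small enough that the parallelogram spanned by \<open>t u\<close> and \<open>t v\<close> stays within \<open>e\<close> of \<open>x\<close>.\<close>
  define t where "t = e / (2 * (norm u + norm v + 1))"
  have t: "t > 0" "t * (norm u + norm v) < e"
  proof -
    show "t > 0" unfolding t_def using e(1) by (intro divide_pos_pos) (auto simp: add_nonneg_pos)
    have "t * (norm u + norm v) \<le> t * (norm u + norm v + 1)"
      using \<open>t > 0\<close> by simp
    also have "\<dots> = e / 2"
      unfolding t_def using norm_ge_zero[of u] norm_ge_zero[of v] by (simp add: field_simps add_nonneg_eq_0_iff)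
    finally show "t * (norm u + norm v) < e" using e(1) by simp
  qed
  \<comment> \<open>Stated for a general pair of directions, to be applied in both orders.\<close>
  have mvt: "\<exists>y. norm (y - x) < e \<and>
      f (x + t *\<^sub>R a + t *\<^sub>R b) - f (x + t *\<^sub>R a) - (f (x + t *\<^sub>R b) - f x) = t * t * dderiv (dderiv f a) b y"
    if ab: "norm a + norm b = norm u + norm v" for a b
  proof -
    have small: "norm ((x + r *\<^sub>R a + s *\<^sub>R b) - x) < e" if "0 \<le> r" "r \<le> t" "0 \<le> s" "s \<le> t" for r s
    proof -
      have "norm ((x + r *\<^sub>R a + s *\<^sub>R b) - x) \<le> r * norm a + s * norm b"
        using norm_triangle_ineq[of "r *\<^sub>R a" "s *\<^sub>R b"] that by simp
      also have "\<dots> \<le> t * (norm a + norm b)"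
        using that by (simp add: distrib_left add_mono mult_right_mono)
      finally show ?thesis using t ab by simp
    qed
    define F where "F r = f (x + r *\<^sub>R a + t *\<^sub>R b) - f (x + r *\<^sub>R a)" for r
    have "\<exists>r. 0 < r \<and> r < t \<and> F t - F 0 = (t - 0) * (dderiv f a (x + r *\<^sub>R a + t *\<^sub>R b) - dderiv f a (x + r *\<^sub>R a))"
    proof (rule MVT2[OF t(1)])
      fix r assume r: "0 \<le> r" "r \<le> t"
      have 1: "((\<lambda>r. f (x + r *\<^sub>R a + s *\<^sub>R b)) has_real_derivative dderiv f a (x + r *\<^sub>R a + s *\<^sub>R b)) (at r)"
        if "0 \<le> s" "s \<le> t" for s
      proof -
        have D: "(f has_derivative (\<lambda>w. dderiv f w (x + r *\<^sub>R a + s *\<^sub>R b))) (at (x + r *\<^sub>R a + s *\<^sub>R b))"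
          using smooth_on_has_derivative[OF f] e(2) small r that by blast
        have eq: "x + r *\<^sub>R a + s *\<^sub>R b = (x + s *\<^sub>R b) + r *\<^sub>R a" for r by simp
        show ?thesis
          using has_derivative_along_line[OF D[unfolded eq]] unfolding eq
          by (simp add: has_field_derivative_def mult_commute_abs)
      qed
      show "(F has_real_derivative dderiv f a (x + r *\<^sub>R a + t *\<^sub>R b) - dderiv f a (x + r *\<^sub>R a)) (at r)"
        unfolding F_def using DERIV_diff[OF 1[of t] 1[of 0]] t(1) by simp
    qed
    then obtain r where r: "0 < r" "r < t" 
      "F t - F 0 = t * (dderiv f a (x + r *\<^sub>R a + t *\<^sub>R b) - dderiv f a (x + r *\<^sub>R a))" by auto
    define G where "G s = dderiv f a (x + r *\<^sub>R a + s *\<^sub>R b)" for s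
    have "\<exists>s. 0 < s \<and> s < t \<and> G t - G 0 = (t - 0) * dderiv (dderiv f a) b (x + r *\<^sub>R a + s *\<^sub>R b)"
    proof (rule MVT2[OF t(1)])
      fix s assume s: "0 \<le> s" "s \<le> t"
      have D: "(dderiv f a has_derivative (\<lambda>w. dderiv (dderiv f a) w (x + r *\<^sub>R a + s *\<^sub>R b))) (at (x + r *\<^sub>R a + s *\<^sub>R b))"
        using smooth_on_has_derivative[OF smooth_on_dderiv[OF f]] e(2) small[of r s] r s by force
      show "(G has_real_derivative dderiv (dderiv f a) b (x + r *\<^sub>R a + s *\<^sub>R b)) (at s)"
        using has_derivative_along_line[OF D]
        by (simp add: G_def[abs_def] has_field_derivative_def mult_commute_abs)
    qed
    then obtain s where s: "0 < s" "s < t" "G t - G 0 = t * dderiv (dderiv f a) b (x + r *\<^sub>R a + s *\<^sub>R b)" by auto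
    show ?thesis
      using small[of r s] r s
      by (intro exI[of _ "x + r *\<^sub>R a + s *\<^sub>R b"]) (auto simp: F_def G_def algebra_simps)
  qed
  obtain y where y: "norm (y - x) < e"
    "f (x + t *\<^sub>R u + t *\<^sub>R v) - f (x + t *\<^sub>R u) - (f (x + t *\<^sub>R v) - f x) = t * t * dderiv (dderiv f u) v y"
    using mvt[of u v] by auto
  obtain y' where y': "norm (y' - x) < e"
    "f (x + t *\<^sub>R v + t *\<^sub>R u) - f (x + t *\<^sub>R v) - (f (x + t *\<^sub>R u) - f x) = t * t * dderiv (dderiv f v) u y'"
    using mvt[of v u] by auto
  have "t * t * dderiv (dderiv f u) v y = t * t * dderiv (dderiv f v) u y'"
    unfolding y(2)[symmetric] y'(2)[symmetric] by (simp add: algebra_simps)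
  then have "dderiv (dderiv f u) v y = dderiv (dderiv f v) u y'"
    using t(1) by simp
  then show False
    using e(3)[OF y(1)] e(4)[OF y'(1)] unfolding d_def by (simp add: abs_if split: if_splits)
qed

section \<open>Closed sets are zero sets of smooth functions\<close>

text \<open>This is \<open>exp (-1/t) / t\<^sup>m\<close> extended by \<open>0\<close>. The exponent \<open>m\<close> is carried along because differentiation
produces negative powers of \<open>t\<close>, and the family is closed under it.\<close>

definition flat_exp :: "nat \<Rightarrow> real \<Rightarrow> real" where
  "flat_exp m t = (if t > 0 then exp (- inverse t) * inverse t ^ m else 0)"

lemma tendsto_flat_exp_0: "(flat_exp m \<longlongrightarrow> 0) (at 0)"
proof -
  have "((\<lambda>t::real. inverse t ^ m / exp (inverse t)) \<longlongrightarrow> 0) (at_right 0)"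
    by (rule filterlim_compose[OF tendsto_power_div_exp_0 filterlim_inverse_at_top_right])
  moreover have "\<forall>\<^sub>F t in at_right 0. inverse t ^ m / exp (inverse t) = flat_exp m t"
    by (rule eventually_at_right_less[THEN eventually_mono])
       (simp add: flat_exp_def exp_minus divide_inverse mult.commute)
  ultimately have "(flat_exp m \<longlongrightarrow> 0) (at_right 0)"
    by (rule Lim_transform_eventually)
  moreover have "(flat_exp m \<longlongrightarrow> 0) (at_left 0)"
    by (rule tendsto_eventually)
       (auto simp: eventually_at_left_field flat_exp_def intro!: exI[of _ "-1"])
  ultimately show ?thesis
    by (simp add: filterlim_split_at)
qed

lemma flat_exp_has_derivative:
  "(flat_exp m has_real_derivative flat_exp (m + 2) t - m * flat_exp (m + 1) t) (at t)"
proof -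
  consider "t > 0" | "t < 0" | "t = 0" by linarith
  then show ?thesis
  proof cases
    case 1
    have "((\<lambda>t. exp (- inverse t) * inverse t ^ m) has_real_derivative
        flat_exp (m + 2) t - m * flat_exp (m + 1) t) (at t)"
    proof -
      have "((\<lambda>t. exp (- inverse t)) has_real_derivative exp (- inverse t) * inverse t ^ 2) (at t)"
        using 1 by (auto intro!: derivative_eq_intros simp: power2_eq_square)
      moreover have "((\<lambda>t. inverse t ^ m) has_real_derivative m * (- (inverse t ^ 2) * inverse t ^ (m - 1))) (at t)"
        using 1 by (auto intro!: derivative_eq_intros simp: power2_eq_square)
      ultimately have "((\<lambda>t. exp (- inverse t) * inverse t ^ m) has_real_derivative
          exp (- inverse t) * inverse t ^ 2 * inverse t ^ m
          + m * (- (inverse t ^ 2) * inverse t ^ (m - 1)) * exp (- inverse t)) (at t)"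
        by (rule DERIV_mult)
      then show ?thesis
        using 1 by (cases m) (simp_all add: flat_exp_def power2_eq_square algebra_simps)
    qed
    then show ?thesis
      by (rule has_field_derivative_transform_within_open[where S = "{0<..}"])
         (use 1 in \<open>auto simp: flat_exp_def\<close>)
  next
    case 2
    have "((\<lambda>t. 0) has_real_derivative flat_exp (m + 2) t - m * flat_exp (m + 1) t) (at t)"
      using 2 by (simp add: flat_exp_def)
    then show ?thesis
      by (rule has_field_derivative_transform_within_open[where S = "{..<0}"])
         (use 2 in \<open>auto simp: flat_exp_def\<close>)
  next
    case 3
    have "(flat_exp m (0 + h) - flat_exp m 0) / h = flat_exp (m + 1) h" for h
      by (auto simp: flat_exp_def divide_inverse)
    then have "(flat_exp m has_real_derivative 0) (at 0)"
      unfolding DERIV_def using tendsto_flat_exp_0[of "m + 1"] by simp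
    then show ?thesis
      using 3 by (simp add: flat_exp_def)
  qed
qed

text \<open>The induction runs over all \<open>m\<close> at once, since the derivative of \<open>flat_exp m\<close> is a combination of
\<open>flat_exp (m + 1)\<close> and \<open>flat_exp (m + 2)\<close>.\<close>

lemma smooth_on_flat_exp:
  assumes "open S" "smooth_on S s"
  shows "smooth_on S (\<lambda>x. flat_exp m (s x))"
proof -
  have "Ck_on k S (\<lambda>x. flat_exp m (s x))" for k
  proof (induction k arbitrary: m)
    case 0
    have "isCont (flat_exp m) t" for t
      using flat_exp_has_derivative by (rule DERIV_isCont)
    then have "continuous_on UNIV (flat_exp m)"
      by (simp add: continuous_on_eq_continuous_at)
    then show ?case
      using smooth_on_continuous_on[OF assms(2)] by (auto intro: continuous_on_compose2)
  next
    case (Suc k)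
    have "((\<lambda>x. flat_exp m (s x)) has_derivative
        (\<lambda>v. (flat_exp (m + 2) (s x) - m * flat_exp (m + 1) (s x)) * dderiv s v x)) (at x)"
      if "x \<in> S" for x
      using has_derivative_compose[OF smooth_on_has_derivative[OF assms(2) that]
          flat_exp_has_derivative[THEN has_field_derivative_imp_has_derivative]] .
    moreover have "Ck_on k S (\<lambda>x. (flat_exp (m + 2) (s x) - m * flat_exp (m + 1) (s x)) * dderiv s v x)"
      for v
    proof -
      have "Ck_on k S (\<lambda>x. (flat_exp (m + 2) (s x) + (- real m) * flat_exp (m + 1) (s x)) * dderiv s v x)"
        using smooth_on_dderiv[OF assms(2)]
        by (intro Ck_on_bilinear[OF assms(1) bounded_bilinear_mult] Ck_on_add Suc.IH Ck_on_const assms(1))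
           (simp add: smooth_on_def)
      then show ?thesis by simp
    qed
    ultimately show ?case
      by (rule Ck_on_SucI[OF assms(1)])
  qed
  then show ?thesis by (simp add: smooth_on_def)
qed

lemma smooth_bump_exists:
  fixes a :: "'a::euclidean_space"
  assumes "r > 0"
  obtains f :: "'a \<Rightarrow> real" where "smooth_on UNIV f" "\<And>x. x \<in> ball a r \<Longrightarrow> f x > 0" "\<And>x. x \<notin> ball a r \<Longrightarrow> f x = 0"
proof -
  have sm: "smooth_on UNIV (\<lambda>x. x + - a)"
    by (intro smooth_on_add smooth_on_id smooth_on_const open_UNIV)
  have "smooth_on UNIV (\<lambda>x. r\<^sup>2 + - ((x + - a) \<bullet> (x + - a)))"
    by (intro smooth_on_add smooth_on_const open_UNIV sm smooth_on_bilinear[OF open_UNIV bounded_bilinear_inner]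
        smooth_on_bounded_linear[OF open_UNIV bounded_linear_minus[OF bounded_linear_ident]])
  moreover have "r\<^sup>2 + - ((x + - a) \<bullet> (x + - a)) = r\<^sup>2 - (dist a x)\<^sup>2" for x
    by (simp add: dist_norm norm_minus_commute[of a x] power2_norm_eq_inner)
  ultimately have "smooth_on UNIV (\<lambda>x. flat_exp 0 (r\<^sup>2 - (dist a x)\<^sup>2))"
    by (intro smooth_on_flat_exp open_UNIV) simp
  moreover have "dist a x < r \<longleftrightarrow> r\<^sup>2 - (dist a x)\<^sup>2 > 0" for x
    using assms power_mono_iff[of r "dist a x" 2] by (simp add: not_le[symmetric])
  ultimately show ?thesis
    by (intro that[of "\<lambda>x. flat_exp 0 (r\<^sup>2 - (dist a x)\<^sup>2)"]) (auto simp: flat_exp_def)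
qed

primrec iter_dderiv :: "'a::euclidean_space list \<Rightarrow> ('a \<Rightarrow> real) \<Rightarrow> 'a \<Rightarrow> real" where
  "iter_dderiv [] f = f"
| "iter_dderiv (v # vs) f = iter_dderiv vs (dderiv f v)"

lemma iter_dderiv_cmult:
  "smooth_on UNIV f \<Longrightarrow> iter_dderiv vs (\<lambda>x. c * f x) = (\<lambda>x. c * iter_dderiv vs f x)"
proof (induction vs arbitrary: f)
  case (Cons v vs)
  have "dderiv (\<lambda>x. c * f x) v x = c * dderiv f v x" for x
    using has_derivative_mult_right[OF smooth_on_has_derivative[OF Cons.prems], of x c]
    by (simp add: frechet_derivative_eqI)
  then show ?case
    by (simp add: Cons.IH[OF smooth_on_dderiv[OF Cons.prems]])
qed simp

lemma bounded_iter_dderiv: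
  assumes "smooth_on UNIV f" "\<And>x. x \<notin> cball a r \<Longrightarrow> f x = 0"
  shows "\<exists>K\<ge>0. \<forall>x. \<bar>iter_dderiv vs f x\<bar> \<le> K"
  using assms
proof (induction vs arbitrary: f)
  case Nil
  have "compact (f ` cball a r)"
    using smooth_on_continuous_on[OF Nil(1)] by (intro compact_continuous_image) (auto intro: continuous_on_subset)
  then obtain K where K: "\<forall>y\<in>f ` cball a r. norm y \<le> K"
    using compact_imp_bounded bounded_iff by metis
  have "\<bar>f x\<bar> \<le> max K 0" for x
    using K Nil(2)[of x] by (cases "x \<in> cball a r") (auto simp: le_max_iff_disj)
  then show ?case
    by (intro exI[of _ "max K 0"]) simp
next
  case (Cons v vs)
  have "dderiv f v x = 0" if "x \<notin> cball a r" for x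
    using frechet_derivative_cong_open[of "- cball a r" x f "\<lambda>_. 0"] that Cons.prems(2)
    by (simp add: open_Compl)
  then show ?case
    using Cons.IH[of "dderiv f v"] smooth_on_dderiv[OF Cons.prems(1)] by simp
qed

text \<open>Termwise differentiation. The hypothesis bounds every iterated partial derivative by a summable
sequence, so it is inherited by the series of partial derivatives, and induction applies. Total
derivatives are recovered from the finitely many partial ones, whose series converge uniformly.\<close>

lemma smooth_series:
  fixes f :: "nat \<Rightarrow> 'a::euclidean_space \<Rightarrow> real"
  assumes "\<And>n. smooth_on UNIV (f n)"
    and "\<And>vs. set vs \<subseteq> Basis \<Longrightarrow> \<exists>M. summable M \<and> (\<forall>n x. \<bar>iter_dderiv vs (f n) x\<bar> \<le> M n)"
  shows "smooth_on UNIV (\<lambda>x. \<Sum>n. f n x)"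
proof -
  have unif: "uniform_limit UNIV (\<lambda>n x. \<Sum>i<n. f i x) (\<lambda>x. \<Sum>i. f i x) sequentially"
    if M: "\<exists>M. summable M \<and> (\<forall>n x. \<bar>f n x\<bar> \<le> M n)" for f :: "nat \<Rightarrow> 'a \<Rightarrow> real"
  proof -
    obtain M where "summable M" "\<And>n x. \<bar>f n x\<bar> \<le> M n" using M by blast
    then show ?thesis by (intro Weierstrass_m_test[of UNIV f M]) simp_all
  qed
  have "Ck_on k UNIV (\<lambda>x. \<Sum>n. f n x)" for k
    using assms
  proof (induction k arbitrary: f)
    case 0
    have "\<forall>n. continuous_on UNIV (\<lambda>x. \<Sum>i<n. f i x)"
      using smooth_on_continuous_on[OF 0(1)] by (auto intro: continuous_on_sum)
    then show ?case
      using uniform_limit_theorem[OF _ unif] 0(2)[of "[]"] by simp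
  next
    case (Suc k)
    define g where "g b x = (\<Sum>n. dderiv (f n) b x)" for b x
    have g: "Ck_on k UNIV (g b)" if "b \<in> Basis" for b
      unfolding g_def
    proof (rule Suc.IH)
      show "smooth_on UNIV (dderiv (f n) b)" for n
        by (rule smooth_on_dderiv[OF Suc.prems(1)])
      show "\<exists>M. summable M \<and> (\<forall>n x. \<bar>iter_dderiv vs (dderiv (f n) b) x\<bar> \<le> M n)" if "set vs \<subseteq> Basis" for vs
        using Suc.prems(2)[of "b # vs"] that \<open>b \<in> Basis\<close> by simp
    qed
    have unif_g: "uniform_limit UNIV (\<lambda>n x. \<Sum>i<n. dderiv (f i) b x) (g b) sequentially" if "b \<in> Basis" for b
      unfolding g_def[abs_def] using unif Suc.prems(2)[of "[b]"] that by simp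
    have sums: "(\<lambda>n. f n x) sums (\<Sum>n. f n x)" for x
      using tendsto_uniform_limitI[OF unif, of f x] Suc.prems(2)[of "[]"] by (simp add: sums_def)
    have "((\<lambda>x. \<Sum>n. f n x) has_derivative (\<lambda>h. \<Sum>b\<in>Basis. (h \<bullet> b) *\<^sub>R g b x)) (at x)" for x
    proof -
      have "\<exists>F. \<forall>x\<in>UNIV. (\<lambda>n. f n x) sums (F x) \<and> (F has_derivative (\<lambda>h. \<Sum>b\<in>Basis. (h \<bullet> b) *\<^sub>R g b x)) (at x within UNIV)"
      proof (rule has_derivative_series)
        show "(f n has_derivative (\<lambda>v. dderiv (f n) v x)) (at x within UNIV)" for n x
          using smooth_on_has_derivative[OF Suc.prems(1)] by simp
        show "\<forall>\<^sub>F n in sequentially. \<forall>x\<in>UNIV. \<forall>h.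
            norm ((\<Sum>i<n. dderiv (f i) h x) - (\<Sum>b\<in>Basis. (h \<bullet> b) *\<^sub>R g b x)) \<le> e * norm h"
          if "e > 0" for e
        proof -
          have "\<forall>\<^sub>F n in sequentially. \<forall>b\<in>Basis. \<forall>x\<in>UNIV. dist (\<Sum>i<n. dderiv (f i) b x) (g b x) < e / DIM('a)"
            using \<open>e > 0\<close>
            by (intro eventually_ball_finite[OF finite_Basis] ballI uniform_limitD[OF unif_g]) auto
          then show ?thesis
          proof (rule eventually_mono, intro ballI allI)
            fix n x and h :: 'a
            assume *: "\<forall>b\<in>Basis. \<forall>x\<in>UNIV. dist (\<Sum>i<n. dderiv (f i) b x) (g b x) < e / DIM('a)"
            have "dderiv (f i) h x = (\<Sum>b\<in>Basis. (h \<bullet> b) * dderiv (f i) b x)" for i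
              using frechet_derivative_linear_sum[OF smooth_on_differentiable[OF Suc.prems(1)], of x i h] by simp
            then have "(\<Sum>i<n. dderiv (f i) h x) = (\<Sum>b\<in>Basis. (h \<bullet> b) * (\<Sum>i<n. dderiv (f i) b x))"
              using sum.swap[of "\<lambda>i b. (h \<bullet> b) * dderiv (f i) b x" Basis "{..<n}"] by (simp add: sum_distrib_left)
            then have "norm ((\<Sum>i<n. dderiv (f i) h x) - (\<Sum>b\<in>Basis. (h \<bullet> b) *\<^sub>R g b x))
              = norm (\<Sum>b\<in>Basis. (h \<bullet> b) * ((\<Sum>i<n. dderiv (f i) b x) - g b x))"
              by (simp add: sum_subtractf right_diff_distrib)
            also have "\<dots> \<le> (\<Sum>b\<in>(Basis::'a set). norm h * (e / DIM('a)))"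
            proof (rule sum_norm_le)
              fix b :: 'a assume b: "b \<in> Basis"
              have "\<bar>(\<Sum>i<n. dderiv (f i) b x) - g b x\<bar> \<le> e / DIM('a)"
                using * b by (auto simp: dist_real_def intro: less_imp_le)
              with Basis_le_norm[OF b, of h]
              show "norm ((h \<bullet> b) * ((\<Sum>i<n. dderiv (f i) b x) - g b x)) \<le> norm h * (e / DIM('a))"
                unfolding real_norm_def abs_mult by (rule mult_mono) auto
            qed
            also have "\<dots> = e * norm h" by simp
            finally show "norm ((\<Sum>i<n. dderiv (f i) h x) - (\<Sum>b\<in>Basis. (h \<bullet> b) *\<^sub>R g b x)) \<le> e * norm h" .
          qed
        qed
        show "(\<lambda>n. f n x) sums (\<Sum>n. f n x)" by (rule sums)
      qed auto
      then obtain F where F: "\<And>x. (\<lambda>n. f n x) sums (F x)" "(F has_derivative (\<lambda>h. \<Sum>b\<in>Basis. (h \<bullet> b) *\<^sub>R g b x)) (at x)"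
        by auto
      have "F = (\<lambda>x. \<Sum>n. f n x)"
        using F(1) sums sums_unique2 by blast
      then show ?thesis using F(2) by simp
    qed
    moreover have "Ck_on k UNIV (\<lambda>x. \<Sum>b\<in>Basis. (h \<bullet> b) *\<^sub>R g b x)" for h
      using g by (intro Ck_on_sum Ck_on_bounded_linear[OF open_UNIV bounded_linear_scaleR_right]) auto
    ultimately show ?case
      by (intro Ck_on_SucI) auto
  qed
  then show ?thesis by (simp add: smooth_on_def)
qed

text \<open>Whitney's theorem. The open set is a countable union of balls; the bump functions of these balls are
added up with weights that decay fast enough to make all series of derivatives converge.\<close>

lemma smooth_function_positive_exactly_on_open_set:
  fixes W :: "'a::euclidean_space set"
  assumes "open W"
  obtains w :: "'a \<Rightarrow> real" where "smooth_on UNIV w" "\<And>x. x \<in> W \<Longrightarrow> w x > 0" "\<And>x. x \<notin> W \<Longrightarrow> w x = 0"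
proof (cases "W = {}")
  case True
  then show ?thesis using that[of "\<lambda>_. 0"] by (simp add: smooth_on_const)
next
  case False
  define \<B> where "\<B> = {B. B \<subseteq> W \<and> (\<exists>a r. r > 0 \<and> B = ball a r)}"
  have "\<And>B. B \<in> \<B> \<Longrightarrow> open B" by (auto simp: \<B>_def)
  then obtain \<C> where \<C>: "\<C> \<subseteq> \<B>" "countable \<C>" "\<Union>\<C> = \<Union>\<B>"
    using Lindelof by metis
  have "\<Union>\<B> = W"
  proof
    show "W \<subseteq> \<Union>\<B>"
    proof
      fix x assume "x \<in> W"
      then obtain e where "e > 0" "ball x e \<subseteq> W"
        using assms open_contains_ball by metis
      then show "x \<in> \<Union>\<B>"
        unfolding \<B>_def by (intro UnionI[of "ball x e"]) auto
    qed
  qed (auto simp: \<B>_def)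
  with False \<C>(3) have "\<C> \<noteq> {}" by auto
  define B where "B = from_nat_into \<C>"
  have B: "range B = \<C>"
    unfolding B_def using \<open>\<C> \<noteq> {}\<close> \<C>(2) by (rule range_from_nat_into)
  have "\<exists>a r. r > 0 \<and> B i = ball a r" for i
  proof -
    have "B i \<in> \<B>" using B \<C>(1) by blast
    then show ?thesis by (simp add: \<B>_def)
  qed
  then obtain a r where ar: "\<And>i. r i > 0" "\<And>i. B i = ball (a i) (r i)" by metis
  have "\<exists>f::'a \<Rightarrow> real. smooth_on UNIV f \<and> (\<forall>x\<in>ball (a i) (r i). f x > 0) \<and> (\<forall>x. x \<notin> ball (a i) (r i) \<longrightarrow> f x = 0)" for i
    by (rule smooth_bump_exists[OF ar(1)[of i], of "a i"]) blast
  then obtain b :: "nat \<Rightarrow> 'a \<Rightarrow> real" where b: "\<And>i. smooth_on UNIV (b i)" "\<And>i x. x \<in> B i \<Longrightarrow> b i x > 0" "\<And>i x. x \<notin> B i \<Longrightarrow> b i x = 0"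
    unfolding ar(2) by metis
  have "\<exists>K\<ge>0. \<forall>x. \<bar>iter_dderiv vs (b i) x\<bar> \<le> K" for i vs
    using b(3)[of _ i] by (intro bounded_iter_dderiv[OF b(1), of "a i" "r i"]) (auto simp: ar(2))
  then have "\<exists>K. \<forall>i vs. 0 \<le> K i vs \<and> (\<forall>x. \<bar>iter_dderiv vs (b i) x\<bar> \<le> K i vs)"
    by (intro choice allI) blast
  then obtain K where K: "\<And>i vs. K i vs \<ge> 0" "\<And>i vs x. \<bar>iter_dderiv vs (b i) x\<bar> \<le> K i vs"
    by blast
  define L where "L i = {vs::'a list. set vs \<subseteq> Basis \<and> length vs \<le> i}" for i
  have finL: "finite (L i)" for i
    unfolding L_def by (intro finite_lists_length_le) simp
  \<comment> \<open>The \<open>i\<close>-th weight tames the partial derivatives of order at most \<open>i\<close>; a fixed order \<open>k\<close> is thus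
    controlled by \<open>(1/2)\<^sup>i\<close> from index \<open>k\<close> on, which suffices for summability.\<close>
  define c where "c i = (1/2) ^ i / (1 + sum (K i) (L i))" for i
  have den: "1 + sum (K i) (L i) > 0" for i
    using K(1) by (simp add: add_pos_nonneg sum_nonneg)
  have c: "c i > 0" for i
    unfolding c_def using den by simp
  define f where "f i x = c i * b i x" for i x
  have "0 \<le> f i x" for i x
    unfolding f_def using b(2,3)[of x i] c[of i] by (cases "x \<in> B i") (auto intro: less_imp_le)
  have bound: "\<exists>M. summable M \<and> (\<forall>n x. \<bar>iter_dderiv vs (f n) x\<bar> \<le> M n)" if vs: "set vs \<subseteq> Basis" for vs
  proof (intro exI conjI allI)
    show "\<bar>iter_dderiv vs (f n) x\<bar> \<le> c n * K n vs" for n x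
      unfolding f_def[abs_def] iter_dderiv_cmult[OF b(1)] using c[of n] K(2)[of vs n x]
      by (simp add: abs_mult)
    show "summable (\<lambda>n. c n * K n vs)"
    proof (rule summable_comparison_test'[where N = "length vs" and g = "\<lambda>n. (1/2::real) ^ n"])
      fix n assume "length vs \<le> n"
      then have "vs \<in> L n" using vs by (simp add: L_def)
      then have "K n vs \<le> 1 + sum (K n) (L n)"
        using member_le_sum[of vs "L n" "K n"] K(1) finL by fastforce
      then have "(1/2) ^ n * (K n vs / (1 + sum (K n) (L n))) \<le> (1/2::real) ^ n * 1"
        using den[of n] by (intro mult_left_mono) auto
      then show "norm (c n * K n vs) \<le> (1/2) ^ n"
        using den[of n] K(1)[of n vs] by (simp add: c_def abs_mult)
    qed simp
  qed
  have summ: "summable (\<lambda>n. f n x)" for x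
    using bound[of "[]"] by (auto intro: summable_comparison_test')
  show ?thesis
  proof (rule that)
    have "smooth_on UNIV (f i)" for i
      unfolding f_def[abs_def] by (intro smooth_on_mult smooth_on_const b(1) open_UNIV)
    then show "smooth_on UNIV (\<lambda>x. \<Sum>n. f n x)"
      using bound by (rule smooth_series)
    show "(\<Sum>n. f n x) > 0" if "x \<in> W" for x
    proof -
      obtain i where "x \<in> B i"
        using \<open>x \<in> W\<close> B \<open>\<Union>\<B> = W\<close> \<C>(3) by blast
      then have "f i x > 0" using b(2) c by (simp add: f_def)
      then show ?thesis
        using suminf_pos2[OF summ] \<open>\<And>i x. 0 \<le> f i x\<close> by blast
    qed
    show "(\<Sum>n. f n x) = 0" if "x \<notin> W" for x
    proof -
      have "x \<notin> B i" for i
        using that B \<C>(1) by (auto simp: \<B>_def)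
      then show ?thesis using b(3) by (simp add: f_def)
    qed
  qed
qed

section \<open>Duality for cones of symmetric matrices\<close>

lemma trace_mult_eq_inner:
  fixes A B :: "real^'n::finite^'n"
  assumes "A \<in> Sym2"
  shows "trace (A ** B) = A \<bullet> B"
proof -
  have "A $ j $ i = A $ i $ j" for i j
    using assms by (metis (mono_tags, lifting) Sym2_def mem_Collect_eq transpose_def vec_lambda_beta)
  then show ?thesis
    using sum.swap[of "\<lambda>i j. A $ i $ j * B $ j $ i" UNIV UNIV]
    by (simp add: trace_def matrix_matrix_mult_def inner_vec_def)
qed

lemma Sym2_inner_matrix_vector:
  fixes A :: "real^'n::finite^'n"
  shows "A \<in> Sym2 \<Longrightarrow> (A *v u) \<bullet> v = u \<bullet> (A *v v)"
  by (metis (mono_tags) Sym2_def mem_Collect_eq dot_lmul_matrix transpose_matrix_vector)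

lemma closed_polar: "closed (polar P)"
proof -
  have "polar P = {A. transpose A = A} \<inter> (\<Inter>B\<in>P. {A. 0 \<le> trace (A ** B)})"
    by (auto simp: polar_def Sym2_def)
  moreover have "closed {A::real^'a^'a. transpose A = A}"
    unfolding transpose_def by (intro closed_Collect_eq continuous_intros)
  moreover have "closed {A::real^'a^'a. 0 \<le> trace (A ** B)}" for B
    unfolding trace_def matrix_matrix_mult_def by (intro closed_Collect_le continuous_intros)
  ultimately show ?thesis
    by (simp only:) (intro closed_Int closed_INT ballI; simp)
qed

text \<open>With \<open>w = A v\<close>, the form at \<open>v - t w\<close> equals \<open>t (t \<langle>w, A w\<rangle> - 2 |w|\<^sup>2)\<close>, which is negative for small
\<open>t > 0\<close> unless \<open>w = 0\<close>.\<close>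

lemma psd_vanishes_on_isotropic:
  fixes A :: "real^'n::finite^'n"
  assumes "A \<in> psd_cone" "v \<bullet> (A *v v) = 0"
  shows "A *v v = 0"
proof (rule ccontr)
  define w where "w = A *v v"
  assume "A *v v \<noteq> 0"
  then have pos: "w \<bullet> w > 0" by (simp add: w_def)
  define c where "c = w \<bullet> (A *v w)"
  have "c \<ge> 0" using assms(1) by (simp add: c_def psd_cone_def)
  \<comment> \<open>Any \<open>t > 0\<close> with \<open>t c < 2 |w|\<^sup>2\<close> would do; the \<open>1\<close> allows for \<open>c = 0\<close>.\<close>
  define t where "t = (w \<bullet> w) / (c + 1)"
  have "t > 0" using pos \<open>c \<ge> 0\<close> by (simp add: t_def)
  have "0 \<le> (v - t *\<^sub>R w) \<bullet> (A *v (v - t *\<^sub>R w))"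
    using assms(1) by (simp add: psd_cone_def)
  also have "\<dots> = t * (t * c - 2 * (w \<bullet> w))"
  proof -
    have "v \<bullet> (A *v w) = w \<bullet> w"
      using Sym2_inner_matrix_vector[of A v w] assms(1) by (simp add: psd_cone_def w_def)
    then show ?thesis
      using assms(2)
      by (simp add: matrix_vector_mult_diff_distrib matrix_vector_mult_scaleR inner_diff_left inner_diff_right
            c_def algebra_simps flip: w_def)
  qed
  finally have "2 * (w \<bullet> w) \<le> t * c"
    using \<open>t > 0\<close> by (simp add: zero_le_mult_iff)
  also have "t * c \<le> w \<bullet> w"
    unfolding t_def using pos \<open>c \<ge> 0\<close> by (simp add: field_simps)
  finally show False using pos by simp
qed

text \<open>The working form of the relative interior: a ball, cut down to the symmetric matrices.\<close>

lemma interior_of_Sym2_iff: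
  assumes "P \<subseteq> Sym2"
  shows "B \<in> (top_of_set Sym2) interior_of P \<longleftrightarrow> B \<in> Sym2 \<and> (\<exists>e>0. ball B e \<inter> Sym2 \<subseteq> P)"
proof
  assume "B \<in> (top_of_set Sym2) interior_of P"
  then obtain T where "openin (top_of_set Sym2) T" "B \<in> T" "T \<subseteq> P"
    by (auto simp: interior_of_def)
  moreover from this obtain e where "e > 0" "ball B e \<inter> Sym2 \<subseteq> T"
    using openin_contains_ball by metis
  ultimately show "B \<in> Sym2 \<and> (\<exists>e>0. ball B e \<inter> Sym2 \<subseteq> P)"
    using assms by blast
next
  assume "B \<in> Sym2 \<and> (\<exists>e>0. ball B e \<inter> Sym2 \<subseteq> P)"
  then obtain e where "B \<in> Sym2" "e > 0" "ball B e \<inter> Sym2 \<subseteq> P" by blast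
  then show "B \<in> (top_of_set Sym2) interior_of P"
    unfolding interior_of_def using openin_open_Int[OF open_ball, of Sym2 B e]
    by (auto intro!: exI[of _ "Sym2 \<inter> ball B e"])
qed

text \<open>An interior \<open>B\<close> with \<open>\<langle>A, B\<rangle> = 0\<close> can be moved to \<open>B - t A\<close> inside \<open>P\<close>, where \<open>A\<close> takes the value
\<open>- t |A|\<^sup>2\<close>.\<close>

lemma polar_zero_on_interior:
  fixes P :: "(real^'n::finite^'n) set"
  assumes "P \<subseteq> Sym2" and A: "A \<in> polar P" and B: "B \<in> (top_of_set Sym2) interior_of P"
    and 0: "A \<bullet> B = 0"
  shows "A = 0"
proof (rule ccontr)
  assume "A \<noteq> 0"
  obtain e where e: "B \<in> Sym2" "e > 0" "ball B e \<inter> Sym2 \<subseteq> P"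
    using B interior_of_Sym2_iff[OF assms(1)] by blast
  define t where "t = e / (2 * norm A)"
  have "t > 0" using e \<open>A \<noteq> 0\<close> by (simp add: t_def)
  have AS: "A \<in> Sym2" using A by (simp add: polar_def)
  have "B - t *\<^sub>R A \<in> P"
  proof -
    have "dist B (B - t *\<^sub>R A) < e"
      using e(2) \<open>A \<noteq> 0\<close> by (simp add: dist_norm t_def)
    moreover have "B - t *\<^sub>R A \<in> Sym2"
      using AS e(1) by (simp add: Sym2_def transpose_def vec_eq_iff)
    ultimately show ?thesis using e(3) by auto
  qed
  then have "0 \<le> A \<bullet> (B - t *\<^sub>R A)"
    using A trace_mult_eq_inner[OF AS] by (auto simp: polar_def)
  also have "\<dots> = - (t * (A \<bullet> A))"
    using 0 by (simp add: inner_diff_right)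
  finally have "t * (A \<bullet> A) \<le> 0" by simp
  moreover have "t * (A \<bullet> A) > 0"
    using \<open>t > 0\<close> \<open>A \<noteq> 0\<close> by simp
  ultimately show False by simp
qed

text \<open>A hyperplane separating \<open>B\<close> from the cone has a normal that is nonnegative on the cone; its symmetric
part has the same inner products with symmetric matrices, so it is a form in the polar.\<close>

lemma bipolar:
  fixes P :: "(real^'n::finite^'n) set"
  assumes "P \<subseteq> Sym2" "closed P" "convex P" "cone P" "P \<noteq> {}" and B: "B \<in> Sym2"
    and pos: "\<And>A. A \<in> polar P \<Longrightarrow> 0 \<le> A \<bullet> B"
  shows "B \<in> P"
proof (rule ccontr)
  assume "B \<notin> P"
  then obtain a b where ab: "a \<bullet> B < b" "\<And>x. x \<in> P \<Longrightarrow> b < a \<bullet> x"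
    using separating_hyperplane_closed_point[OF assms(3,2)] by metis
  have "0 \<in> P"
    using assms(4,5) by (metis cone_def equals0I order_refl scaleR_zero_left)
  then have "b < 0" using ab(2)[of 0] by simp
  have ge: "0 \<le> a \<bullet> x" if "x \<in> P" for x
  proof (rule ccontr)
    assume neg: "\<not> 0 \<le> a \<bullet> x"
    \<comment> \<open>At this multiple of \<open>x\<close> the value would be \<open>b\<close>, but all values on the cone exceed \<open>b\<close>.\<close>
    then have "(b / (a \<bullet> x)) *\<^sub>R x \<in> P"
      using \<open>b < 0\<close> that assms(4) by (simp add: cone_def divide_nonpos_neg)
    then show False using ab(2) neg by fastforce
  qed
  define A where "A = (1/2) *\<^sub>R (a + transpose a)"
  have AS: "A \<in> Sym2"
    by (simp add: A_def Sym2_def transpose_def vec_eq_iff add.commute)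
  have eq: "A \<bullet> x = a \<bullet> x" if "x \<in> Sym2" for x
  proof -
    have "x $ j $ i = x $ i $ j" for i j
      using that by (metis (mono_tags, lifting) Sym2_def mem_Collect_eq transpose_def vec_lambda_beta)
    then have "transpose a \<bullet> x = a \<bullet> x"
      using sum.swap[of "\<lambda>i j. a $ i $ j * x $ i $ j" UNIV UNIV]
      by (simp add: inner_vec_def transpose_def)
    then show ?thesis by (simp add: A_def inner_add_left)
  qed
  have "A \<in> polar P"
    using AS eq ge assms(1) by (auto simp: polar_def trace_mult_eq_inner)
  then show False
    using pos[of A] eq[OF B] ab(1) \<open>b < 0\<close> by simp
qed

text \<open>On the compact set of unit vectors of the polar, \<open>\<langle>A, B\<rangle>\<close> has a positive minimum \<open>e\<close>. All symmetric
\<open>C\<close> within distance \<open>e\<close> of \<open>B\<close> are then nonnegative on the polar, hence lie in \<open>P\<close>.\<close>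

lemma interior_of_cone_if_positive_on_polar:
  fixes P :: "(real^'n::finite^'n) set"
  assumes P: "P \<subseteq> Sym2" "closed P" "convex P" "cone P" "P \<noteq> {}" and B: "B \<in> Sym2"
    and pos: "\<And>A. A \<in> polar P \<Longrightarrow> A \<noteq> 0 \<Longrightarrow> 0 < A \<bullet> B"
  shows "B \<in> (top_of_set Sym2) interior_of P"
proof -
  define K where "K = polar P \<inter> sphere 0 1"
  have "compact K"
    unfolding K_def by (intro closed_Int_compact closed_polar) simp
  have "\<exists>e>0. \<forall>A\<in>K. e \<le> A \<bullet> B"
  proof (cases "K = {}")
    case True
    then show ?thesis by (auto intro: exI[of _ 1])
  next
    case False
    have "continuous_on K (\<lambda>A. A \<bullet> B)" by (intro continuous_intros)
    then obtain A where "A \<in> K" "\<And>A'. A' \<in> K \<Longrightarrow> A \<bullet> B \<le> A' \<bullet> B"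
      using continuous_attains_inf[OF \<open>compact K\<close> False, of "\<lambda>A. A \<bullet> B"] by blast
    moreover have "A \<bullet> B > 0" using \<open>A \<in> K\<close> pos[of A] by (fastforce simp: K_def)
    ultimately show ?thesis by blast
  qed
  then obtain e where e: "e > 0" "\<And>A. A \<in> K \<Longrightarrow> e \<le> A \<bullet> B" by blast
  have "ball B e \<inter> Sym2 \<subseteq> P"
  proof
    fix C assume C: "C \<in> ball B e \<inter> Sym2"
    show "C \<in> P"
    proof (rule bipolar[OF P])
      show "C \<in> Sym2" using C by simp
      fix A assume A: "A \<in> polar P"
      show "0 \<le> A \<bullet> C"
      proof (cases "A = 0")
        case False
        have "(1 / norm A) *\<^sub>R A \<in> polar P"
          using A by (simp add: polar_def Sym2_def transpose_def vec_eq_iff trace_def matrix_matrix_mult_def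
              sum_nonneg mult.assoc flip: sum_divide_distrib sum_distrib_left)
        then have "(1 / norm A) *\<^sub>R A \<in> K" using False by (simp add: K_def)
        from e(2)[OF this] have "e * norm A \<le> A \<bullet> B"
          using False by (simp add: field_simps)
        moreover have "\<bar>A \<bullet> (C - B)\<bar> \<le> norm A * norm (C - B)"
          by (rule Cauchy_Schwarz_ineq2)
        moreover have "norm A * norm (C - B) \<le> norm A * e"
          using C by (intro mult_left_mono) (auto simp: dist_norm norm_minus_commute)
        ultimately show ?thesis
          by (simp add: inner_diff_right mult.commute)
      qed simp
    qed
  qed
  then show ?thesis
    using interior_of_Sym2_iff[OF P(1)] B e(1) by blast
qed

text \<open>The projection is specified through its kernel because it serves to write a linear subspace, and
then a submanifold, as the solution set of equations.\<close>

lemma orthogonal_projection_matrix_exists: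
  fixes L :: "(real^'n::finite) set"
  assumes "subspace L"
  obtains Q :: "real^'n^'n" where "transpose Q = Q" "Q ** Q = Q" "\<And>y. Q *v y = 0 \<longleftrightarrow> y \<in> L"
proof -
  obtain B where B: "B \<subseteq> L" "pairwise orthogonal B" "\<And>x. x \<in> B \<Longrightarrow> norm x = 1" "independent B" "span B = L"
    using orthonormal_basis_subspace[OF assms] by metis
  have "finite B" using B(4) independent_imp_finite by blast
  define p where "p y = (\<Sum>b\<in>B. (b \<bullet> y) *\<^sub>R b)" for y
  have lin: "linear (\<lambda>y. y - p y)"
    unfolding p_def
    by (intro linearI) (simp_all add: inner_add_right scaleR_add_left sum.distrib scaleR_sum_right algebra_simps)
  have pL: "p y \<in> L" for y
    unfolding p_def using B(1) assms by (intro subspace_sum subspace_scale) auto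
  have pb: "b \<bullet> p y = b \<bullet> y" if "b \<in> B" for b y
  proof -
    have "b \<bullet> p y = (\<Sum>c\<in>B. (c \<bullet> y) * (b \<bullet> c))"
      by (simp add: p_def inner_sum_right)
    also have "\<dots> = (\<Sum>c\<in>B. if c = b then b \<bullet> y else 0)"
      using B(2,3) that by (intro sum.cong) (auto simp: pairwise_def orthogonal_def dot_square_norm)
    finally show ?thesis using that \<open>finite B\<close> by simp
  qed
  have p_id: "p y = y" if "y \<in> L" for y
  proof -
    have "linear p"
      unfolding p_def by (intro linearI) (simp_all add: inner_add_right scaleR_add_left sum.distrib scaleR_sum_right)
    moreover have "p b = b" if "b \<in> B" for b
    proof -
      have "p b = (\<Sum>c\<in>B. if c = b then b else 0)"
        unfolding p_def using B(2,3) that by (intro sum.cong) (auto simp: pairwise_def orthogonal_def dot_square_norm)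
      then show ?thesis using that \<open>finite B\<close> by simp
    qed
    ultimately show ?thesis
      using linear_eq_on_span[of p "\<lambda>x. x" B y] that B(5) linear_ident by blast
  qed
  have sym: "(y - p y) \<bullet> x = y \<bullet> (x - p x)" for x y
    by (simp add: p_def inner_diff_left inner_diff_right inner_sum_left inner_sum_right mult.commute inner_commute)
  define Q where "Q = matrix (\<lambda>y. y - p y)"
  have Q: "Q *v y = y - p y" for y
    unfolding Q_def using lin by (simp add: matrix_works linear_matrix_vector_mul_eq)
  show ?thesis
  proof
    show "Q *v y = 0 \<longleftrightarrow> y \<in> L" for y
      using Q pL[of y] p_id[of y] by auto
    have "(transpose Q *v y) \<bullet> x = (Q *v y) \<bullet> x" for x y
      using sym[of y x] by (simp add: Q[symmetric]) (metis dot_lmul_matrix transpose_matrix_vector)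
    then show "transpose Q = Q"
      by (metis matrix_eq vector_eq_rdot)
    have "Q *v (Q *v y) = Q *v y" for y
      using p_id[OF pL, of y] Q by (simp add: Q linear_diff[OF lin] matrix_vector_mult_diff_distrib)
    then show "Q ** Q = Q"
      by (simp add: matrix_eq matrix_vector_mul_assoc[symmetric])
  qed
qed

section \<open>Gradients and Hessians\<close>

lemma Hess_nth: "Hess f x $ i $ j = dderiv (dderiv f (axis j 1)) (axis i 1) x"
proof -
  have "partial_deriv j f = dderiv f (axis j 1)"
    by (rule ext) (simp add: partial_deriv_def)
  then show ?thesis by (simp add: Hess_def partial_deriv_def)
qed

lemma Hess_in_Sym2: "open S \<Longrightarrow> x \<in> S \<Longrightarrow> smooth_on S f \<Longrightarrow> Hess f x \<in> Sym2"
  by (simp add: Sym2_def transpose_def vec_eq_iff Hess_nth second_derivative_symmetric)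

lemma continuous_on_Hess: "smooth_on S f \<Longrightarrow> continuous_on S (Hess f)"
proof -
  assume f: "smooth_on S f"
  have "continuous_on S (\<lambda>x. \<chi> i j. dderiv (dderiv f (axis j 1)) (axis i 1) x)"
    by (intro continuous_on_vec_lambda smooth_on_continuous_on smooth_on_dderiv f)
  moreover have "Hess f = (\<lambda>x. \<chi> i j. dderiv (dderiv f (axis j 1)) (axis i 1) x)"
    by (rule ext) (simp add: vec_eq_iff Hess_nth)
  ultimately show ?thesis by simp
qed

definition grad :: "(real^'n::finite \<Rightarrow> real) \<Rightarrow> real^'n \<Rightarrow> real^'n" where
  "grad f x = (\<chi> j. dderiv f (axis j 1) x)"

lemma smooth_on_grad: "open S \<Longrightarrow> smooth_on S f \<Longrightarrow> smooth_on S (grad f)"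
  unfolding grad_def[abs_def] by (intro smooth_on_vec_lambda smooth_on_dderiv)

lemma dderiv_axis_sum:
  fixes f :: "real^'n::finite \<Rightarrow> 'b::real_normed_vector"
  assumes "f differentiable (at x)"
  shows "dderiv f v x = (\<Sum>i\<in>UNIV. v $ i *\<^sub>R dderiv f (axis i 1) x)"
proof -
  interpret D: linear "frechet_derivative f (at x)"
    by (rule linear_frechet_derivative[OF assms])
  have "(\<Sum>i\<in>UNIV. v $ i *\<^sub>R axis i 1) = v"
    by (simp add: vec_eq_iff axis_def if_distrib cong: if_cong)
  then have "dderiv f v x = dderiv f (\<Sum>i\<in>UNIV. v $ i *\<^sub>R axis i 1) x" by simp
  then show ?thesis by (simp add: D.sum D.scale)
qed

text \<open>Differentiating the gradient yields the transpose of \<open>Hess f x\<close>; symmetry of second derivatives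
removes the transposition.\<close>

lemma grad_has_derivative:
  assumes "open S" "x \<in> S" "smooth_on S f"
  shows "(grad f has_derivative (\<lambda>v. Hess f x *v v)) (at x)"
proof -
  have "dderiv (grad f) v x = Hess f x *v v" for v
  proof -
    have "((\<lambda>x. grad f x $ j) has_derivative (\<lambda>v. dderiv (grad f) v x $ j)) (at x)" for j
      by (rule bounded_linear.has_derivative[OF bounded_linear_vec_nth
            smooth_on_has_derivative[OF smooth_on_grad[OF assms(1,3)] assms(2)]])
    from frechet_derivative_eqI[OF this]
    have 1: "dderiv (grad f) v x $ j = dderiv (dderiv f (axis j 1)) v x" for j
      by (simp add: grad_def fun_eq_iff)
    have sym: "Hess f x $ i $ j = Hess f x $ j $ i" for i j
      unfolding Hess_nth by (rule second_derivative_symmetric[OF assms])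
    have "dderiv (dderiv f (axis j 1)) v x = (\<Sum>i\<in>UNIV. v $ i * Hess f x $ i $ j)" for j
      unfolding dderiv_axis_sum[OF smooth_on_differentiable[OF smooth_on_dderiv[OF assms(3)] assms(2)], of "axis j 1" v]
      by (simp add: Hess_nth)
    also have "(\<Sum>i\<in>UNIV. v $ i * Hess f x $ i $ j) = (Hess f x *v v) $ j" for j
      unfolding sym[of _ j] by (simp add: matrix_vector_mult_def mult.commute)
    finally show ?thesis by (simp add: vec_eq_iff 1)
  qed
  then show ?thesis
    using smooth_on_has_derivative[OF smooth_on_grad[OF assms(1,3)] assms(2)] by simp
qed

lemma grad_zero_at_minimum:
  assumes "open S" "x \<in> S" "smooth_on S f" "\<And>y. y \<in> S \<Longrightarrow> f x \<le> f y"
  shows "grad f x = 0"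
proof -
  have "(\<lambda>v. dderiv f v x) = (\<lambda>v. 0)"
    by (rule differential_zero_maxmin[OF assms(2,1) smooth_on_has_derivative[OF assms(3,2)]]) (use assms(4) in blast)
  then show ?thesis
    by (simp add: grad_def vec_eq_iff fun_eq_iff)
qed

text \<open>The terms with second derivatives of \<open>\<Phi>\<close> carry a factor \<open>\<Phi> z = 0\<close>.\<close>

lemma Hess_inner_self_at_zero:
  fixes \<Phi> :: "real^'n::finite \<Rightarrow> 'b::euclidean_space"
  assumes S: "open S" "z \<in> S" and \<Phi>: "smooth_on S \<Phi>" and 0: "\<Phi> z = 0"
  shows "Hess (\<lambda>x. \<Phi> x \<bullet> \<Phi> x) z $ i $ j = 2 * (dderiv \<Phi> (axis i 1) z \<bullet> dderiv \<Phi> (axis j 1) z)"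
proof -
  have 1: "dderiv (\<lambda>x. \<Phi> x \<bullet> \<Phi> x) v x = 2 * (\<Phi> x \<bullet> dderiv \<Phi> v x)" if "x \<in> S" for v x
  proof -
    have D: "(\<Phi> has_derivative (\<lambda>v. dderiv \<Phi> v x)) (at x)"
      by (rule smooth_on_has_derivative[OF \<Phi> that])
    show ?thesis
      using frechet_derivative_eqI[OF has_derivative_inner[OF D D]] by (simp add: inner_commute)
  qed
  have D: "((\<lambda>x. 2 * (\<Phi> x \<bullet> dderiv \<Phi> v x)) has_derivative
      (\<lambda>u. 2 * (\<Phi> z \<bullet> dderiv (dderiv \<Phi> v) u z + dderiv \<Phi> u z \<bullet> dderiv \<Phi> v z))) (at z)" for v
    by (intro has_derivative_mult_right has_derivative_inner smooth_on_has_derivative[OF _ S(2)] smooth_on_dderiv \<Phi>)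
  have "dderiv (dderiv (\<lambda>x. \<Phi> x \<bullet> \<Phi> x) v) u z = 2 * (dderiv \<Phi> u z \<bullet> dderiv \<Phi> v z)" for u v
    using frechet_derivative_cong_open[OF S 1[of _ v]] frechet_derivative_eqI[OF D[of v]] 0 by simp
  then show ?thesis by (simp add: Hess_nth)
qed

text \<open>The Hessian of \<open>|\<Phi>|\<^sup>2\<close> at a zero is twice the sum of \<open>r r\<^sup>T\<close> over the gradients \<open>r\<close> of the components
of \<open>\<Phi>\<close>.\<close>

lemma inner_Hess_inner_self_at_zero:
  fixes \<Phi> :: "real^'n::finite \<Rightarrow> 'b::euclidean_space" and A :: "real^'n^'n"
  assumes "open S" "z \<in> S" "smooth_on S \<Phi>" "\<Phi> z = 0"
  defines "r \<equiv> \<lambda>b. \<chi> i. dderiv \<Phi> (axis i 1) z \<bullet> b"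
  shows "A \<bullet> Hess (\<lambda>x. \<Phi> x \<bullet> \<Phi> x) z = 2 * (\<Sum>b\<in>Basis. r b \<bullet> (A *v r b))"
proof -
  have H: "Hess (\<lambda>x. \<Phi> x \<bullet> \<Phi> x) z $ i $ j = 2 * (\<Sum>b\<in>Basis. r b $ i * r b $ j)" for i j
    unfolding Hess_inner_self_at_zero[OF assms(1-4)] by (subst euclidean_inner) (simp add: r_def)
  have "A \<bullet> Hess (\<lambda>x. \<Phi> x \<bullet> \<Phi> x) z = (\<Sum>i\<in>UNIV. \<Sum>j\<in>UNIV. A $ i $ j * (2 * (\<Sum>b\<in>Basis. r b $ i * r b $ j)))"
    unfolding inner_vec_def[of A] inner_vec_def[of "A $ _"]
    by (simp add: H)
  also have "\<dots> = (\<Sum>i\<in>UNIV. \<Sum>j\<in>UNIV. \<Sum>b\<in>Basis. 2 * (r b $ i * (A $ i $ j * r b $ j)))"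
    by (simp add: sum_distrib_left mult_ac)
  also have "\<dots> = (\<Sum>i\<in>UNIV. \<Sum>b\<in>Basis. \<Sum>j\<in>UNIV. 2 * (r b $ i * (A $ i $ j * r b $ j)))"
    by (intro sum.cong refl sum.swap)
  also have "\<dots> = (\<Sum>b\<in>Basis. \<Sum>i\<in>UNIV. \<Sum>j\<in>UNIV. 2 * (r b $ i * (A $ i $ j * r b $ j)))"
    by (rule sum.swap)
  also have "\<dots> = 2 * (\<Sum>b\<in>Basis. r b \<bullet> (A *v r b))"
    by (simp add: inner_vec_def matrix_vector_mult_def sum_distrib_left)
  finally show ?thesis .
qed

text \<open>Membership in the interior spreads from a point to a neighborhood. This is how conditions verified at
the single point \<open>z\<close> are extended to an open set.\<close>

lemma interior_of_Sym2_stable_under_continuity: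
  assumes "open S" "z \<in> S" "continuous_on S F" "\<And>x. x \<in> S \<Longrightarrow> F x \<in> Sym2"
    and "F z \<in> (top_of_set Sym2) interior_of P"
  obtains T where "open T" "z \<in> T" "T \<subseteq> S" "\<And>x. x \<in> T \<Longrightarrow> F x \<in> (top_of_set Sym2) interior_of P"
proof -
  obtain W where W: "open W" "(top_of_set Sym2) interior_of P = Sym2 \<inter> W"
    using openin_interior_of[of "top_of_set Sym2" P] openin_open by metis
  show ?thesis
  proof (rule that[of "S \<inter> F -` W"])
    show "open (S \<inter> F -` W)"
      using continuous_open_preimage[OF assms(3,1) W(1)] .
  qed (use W assms in auto)
qed

section \<open>Tangent spaces of submanifolds\<close>

lemma derivative_zero_along_curve:
  assumes \<gamma>: "(\<gamma> has_vector_derivative v) (at (0::real))" and F: "(F has_derivative D) (at (\<gamma> 0))"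
    and "\<epsilon> > 0" "\<And>t. \<bar>t\<bar> < \<epsilon> \<Longrightarrow> F (\<gamma> t) = 0"
  shows "D v = 0"
proof -
  have "((\<lambda>t. F (\<gamma> t)) has_derivative (\<lambda>h. D (h *\<^sub>R v))) (at 0)"
    using has_derivative_compose[OF \<gamma>[unfolded has_vector_derivative_def] F] .
  moreover have "frechet_derivative (\<lambda>t. F (\<gamma> t)) (at 0) = frechet_derivative (\<lambda>t. 0) (at (0::real))"
    by (rule frechet_derivative_cong_open[of "{-\<epsilon><..<\<epsilon>}"]) (use assms(3,4) in auto)
  ultimately have "(\<lambda>h. D (h *\<^sub>R v)) = (\<lambda>h. 0)"
    by (simp add: frechet_derivative_eqI)
  from fun_cong[OF this, of 1] show ?thesis by simp
qed

lemma smooth_on_along_line: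
  fixes S :: "real set"
  assumes "open S" "smooth_on V h" "\<And>t. t \<in> S \<Longrightarrow> a + t *\<^sub>R u \<in> V"
  shows "smooth_on S (\<lambda>t. h (a + t *\<^sub>R u))"
proof -
  have "Ck_on k S (\<lambda>t. h (a + t *\<^sub>R u))" for k
    using assms(2)
  proof (induction k arbitrary: h)
    case 0
    then show ?case
      using assms(3) smooth_on_continuous_on[OF 0]
      by (auto intro!: continuous_on_compose2[of V h] continuous_intros)
  next
    case (Suc k)
    show ?case
    proof (rule Ck_on_SucI[OF assms(1)])
      show "((\<lambda>t. h (a + t *\<^sub>R u)) has_derivative (\<lambda>s. s *\<^sub>R dderiv h u (a + t *\<^sub>R u))) (at t)"
        if "t \<in> S" for t
        by (rule has_derivative_along_line[OF smooth_on_has_derivative[OF Suc.prems assms(3)[OF that]]])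
      show "Ck_on k S (\<lambda>t. s *\<^sub>R dderiv h u (a + t *\<^sub>R u))" for s
        by (rule Ck_on_bounded_linear[OF assms(1) bounded_linear_scaleR_right Suc.IH[OF smooth_on_dderiv[OF Suc.prems]]])
    qed
  qed
  then show ?thesis by (simp add: smooth_on_def)
qed

text \<open>A curve in \<open>M\<close> is mapped by \<open>\<phi>\<close> into \<open>L\<close>, which as a linear subspace also contains the velocity of
the image. Conversely, a vector whose image lies in \<open>L\<close> is the velocity of the curve that \<open>\<psi>\<close>
makes out of a straight line in \<open>L\<close>.\<close>

lemma tangent_space_slice_chart:
  fixes M :: "(real^'n::finite) set"
  assumes diffeo: "diffeomorphism U V \<phi> \<psi>" and L: "subspace L" and slice: "\<phi> ` (M \<inter> U) = V \<inter> L"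
    and x: "x \<in> M" "x \<in> U"
  shows "tangent_space M x = {v. dderiv \<phi> v x \<in> L}"
proof -
  have U: "open U" and V: "open V" and sm: "smooth_on U \<phi>" "smooth_on V \<psi>"
    and inv: "\<And>y. y \<in> U \<Longrightarrow> \<psi> (\<phi> y) = y" "\<And>y. y \<in> V \<Longrightarrow> \<phi> (\<psi> y) = y"
    and maps: "\<And>y. y \<in> U \<Longrightarrow> \<phi> y \<in> V" "\<And>y. y \<in> V \<Longrightarrow> \<psi> y \<in> U"
    using diffeo unfolding diffeomorphism_def homeomorphism_def by auto
  have D\<phi>: "(\<phi> has_derivative (\<lambda>v. dderiv \<phi> v x)) (at x)"
    by (rule smooth_on_has_derivative[OF sm(1) x(2)])
  have D\<psi>: "(\<psi> has_derivative (\<lambda>v. dderiv \<psi> v (\<phi> x))) (at (\<phi> x))"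
    by (rule smooth_on_has_derivative[OF sm(2) maps(1)[OF x(2)]])
  show ?thesis
  proof (intro set_eqI iffI)
    fix v assume "v \<in> tangent_space M x"
    then obtain \<gamma> \<epsilon> where \<gamma>: "0 < \<epsilon>" "smooth_on {-\<epsilon><..<\<epsilon>} \<gamma>" "\<gamma> ` {-\<epsilon><..<\<epsilon>} \<subseteq> M" "\<gamma> 0 = x"
      "(\<gamma> has_vector_derivative v) (at (0::real))"
      unfolding tangent_space_def by blast
    obtain Q :: "real^'n^'n" where Q: "\<And>y. Q *v y = 0 \<longleftrightarrow> y \<in> L"
      by (rule orthogonal_projection_matrix_exists[OF L]) blast
    have "open ({-\<epsilon><..<\<epsilon>} \<inter> \<gamma> -` U)"
      using continuous_open_preimage[OF smooth_on_continuous_on[OF \<gamma>(2)] _ U] by simp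
    moreover have "0 \<in> {-\<epsilon><..<\<epsilon>} \<inter> \<gamma> -` U"
      using \<gamma>(1,4) x(2) by simp
    ultimately obtain \<delta> where \<delta>: "\<delta> > 0" "ball 0 \<delta> \<subseteq> {-\<epsilon><..<\<epsilon>} \<inter> \<gamma> -` U"
      using open_contains_ball by metis
    have "Q *v dderiv \<phi> v x = 0"
    proof (rule derivative_zero_along_curve[OF \<gamma>(5) _ \<delta>(1)])
      show "((\<lambda>y. Q *v \<phi> y) has_derivative (\<lambda>v. Q *v dderiv \<phi> v x)) (at (\<gamma> 0))"
        unfolding \<gamma>(4) by (rule bounded_linear.has_derivative[OF matrix_vector_mul_bounded_linear D\<phi>])
      show "Q *v \<phi> (\<gamma> t) = 0" if "\<bar>t\<bar> < \<delta>" for t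
      proof -
        have "t \<in> ball 0 \<delta>" using that by simp
        with \<delta>(2) have "t \<in> {-\<epsilon><..<\<epsilon>}" "\<gamma> t \<in> U" by blast+
        with \<gamma>(3) have "\<phi> (\<gamma> t) \<in> \<phi> ` (M \<inter> U)" by blast
        then show ?thesis using slice Q by simp
      qed
    qed
    then show "v \<in> {v. dderiv \<phi> v x \<in> L}" using Q by simp
  next
    fix v assume "v \<in> {v. dderiv \<phi> v x \<in> L}"
    define u where "u = dderiv \<phi> v x"
    have uL: "u \<in> L" using \<open>v \<in> _\<close> by (simp add: u_def)
    have xL: "\<phi> x \<in> L" using slice x by blast
    have "dderiv \<psi> u (\<phi> x) = v"
    proof -
      have "frechet_derivative (\<lambda>y. \<psi> (\<phi> y)) (at x) = frechet_derivative (\<lambda>y. y) (at x)"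
        by (rule frechet_derivative_cong_open[OF U x(2) inv(1)])
      moreover have "frechet_derivative (\<lambda>y. y) (at x) = (\<lambda>v. v)"
        by (rule frechet_derivative_eqI) simp
      ultimately show ?thesis
        using frechet_derivative_eqI[OF has_derivative_compose[OF D\<phi> D\<psi>]] by (metis u_def)
    qed
    obtain e where e: "e > 0" "ball (\<phi> x) e \<subseteq> V"
      using V maps(1)[OF x(2)] open_contains_ball by metis
    define \<epsilon> where "\<epsilon> = e / (norm u + 1)"
    have "\<epsilon> > 0" unfolding \<epsilon>_def using e(1) by (intro divide_pos_pos) (simp_all add: add_nonneg_pos)
    have inV: "\<phi> x + t *\<^sub>R u \<in> V" if "t \<in> {-\<epsilon><..<\<epsilon>}" for t
    proof -
      have "norm (t *\<^sub>R u) \<le> \<bar>t\<bar> * (norm u + 1)" by (simp add: distrib_left)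
      also have "\<dots> < \<epsilon> * (norm u + 1)"
        using that by (intro mult_strict_right_mono) (auto simp: add_nonneg_pos)
      also have "\<dots> = e"
        unfolding \<epsilon>_def using norm_ge_zero[of u] by (simp add: add_nonneg_eq_0_iff)
      finally show ?thesis using e(2) by (auto simp: dist_norm)
    qed
    define \<gamma> where "\<gamma> t = \<psi> (\<phi> x + t *\<^sub>R u)" for t
    have "smooth_on {-\<epsilon><..<\<epsilon>} \<gamma>"
      unfolding \<gamma>_def[abs_def] by (rule smooth_on_along_line[OF _ sm(2) inV]) simp_all
    moreover have "\<gamma> t \<in> M" if "t \<in> {-\<epsilon><..<\<epsilon>}" for t
    proof -
      have "\<phi> x + t *\<^sub>R u \<in> V \<inter> L"
        using inV[OF that] xL uL L by (simp add: subspace_add subspace_scale)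
      then obtain y where "y \<in> M" "y \<in> U" "\<phi> x + t *\<^sub>R u = \<phi> y" using slice by blast
      then show ?thesis unfolding \<gamma>_def using inv(1) by simp
    qed
    moreover have "\<gamma> 0 = x" using inv(1) x(2) by (simp add: \<gamma>_def)
    moreover have "(\<gamma> has_vector_derivative v) (at 0)"
    proof -
      have "(\<psi> has_derivative (\<lambda>v. dderiv \<psi> v (\<phi> x))) (at (\<phi> x + 0 *\<^sub>R u))"
        using D\<psi> by simp
      from has_derivative_along_line[OF this] show ?thesis
        unfolding \<gamma>_def[abs_def] has_vector_derivative_def using \<open>dderiv \<psi> u (\<phi> x) = v\<close> by simp
    qed
    ultimately show "v \<in> tangent_space M x"
      unfolding tangent_space_def using \<open>\<epsilon> > 0\<close> by blast
  qed
qed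

section \<open>Zero sets lie in free submanifolds\<close>

lemma Sym2D: "A \<in> Sym2 \<Longrightarrow> transpose A = A"
  by (simp add: Sym2_def)

lemma zero_in_polar_Sym2_sub: "0 \<in> polar P \<inter> Sym2_sub W"
  by (simp add: polar_def Sym2_sub_def Sym2_def transpose_def vec_eq_iff trace_def matrix_matrix_mult_def)

text \<open>The chart \<open>\<phi>\<close> keeps the component of \<open>x\<close> in \<open>ker H\<close> and replaces the complementary one by
\<open>Q grad f x\<close>. It therefore maps \<open>M = {Q grad f = 0}\<close> into \<open>ker H\<close>, and its derivative at \<open>z\<close> is
injective because \<open>H\<close> is injective on the range of \<open>Q\<close>. Freeness at points other than \<open>z\<close> comes from
the matrix \<open>G x\<close>: it is orthogonal to every form carried by the tangent space at \<open>x\<close>, and stays in the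
interior of \<open>P\<close> by continuity.\<close>

lemma zero_set_locally_in_free_submanifold:
  fixes P :: "(real^'n::finite^'n) set"
  assumes P: "P \<subseteq> Sym2" and X: "open X" "z \<in> X" and f: "strictly_psh_on P X f"
    and nonneg: "\<And>x. x \<in> X \<Longrightarrow> 0 \<le> f x" and "f z = 0"
  obtains U M where "open U" "z \<in> U" "U \<subseteq> X" "free_closed_submanifold P U M" "{x \<in> U. f x = 0} \<subseteq> M"
proof -
  have sm: "smooth_on X f" and int: "\<And>x. x \<in> X \<Longrightarrow> Hess f x \<in> (top_of_set Sym2) interior_of P"
    using f by (auto simp: strictly_psh_on_def)
  have symH: "Hess f x \<in> Sym2" if "x \<in> X" for x
    by (rule Hess_in_Sym2[OF X(1) that sm])
  define H where "H = Hess f z"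
  define L where "L = {v. H *v v = 0}"
  have L: "subspace L"
    unfolding L_def by (simp add: subspace_def matrix_vector_right_distrib matrix_vector_mult_scaleR)
  obtain Q :: "real^'n^'n" where Q: "transpose Q = Q" "Q ** Q = Q" "\<And>y. Q *v y = 0 \<longleftrightarrow> y \<in> L"
    by (rule orthogonal_projection_matrix_exists[OF L]) blast
  have QQ: "Q *v (Q *v y) = Q *v y" for y
    by (simp add: matrix_vector_mul_assoc Q(2))
  have "H *v (Q *v y) = H *v y" for y
  proof -
    have "Q *v (y - Q *v y) = 0" by (simp add: matrix_vector_mult_diff_distrib QQ)
    then have "H *v (y - Q *v y) = 0" using Q(3) by (simp only: L_def mem_Collect_eq)
    then show ?thesis by (simp add: matrix_vector_mult_diff_distrib)
  qed
  then have HQ: "H ** Q = H"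
    by (simp add: matrix_eq matrix_vector_mul_assoc[symmetric])
  have "transpose H = H" using symH[OF X(2)] by (simp add: H_def Sym2_def)
  with HQ have QH: "Q ** H = H" by (metis Q(1) matrix_transpose_mul)
  \<comment> \<open>The symmetrization of \<open>Hess f x ** Q\<close>, which is \<open>H\<close> at \<open>z\<close>.\<close>
  define G where "G x = (1/2) *\<^sub>R (Hess f x ** Q + Q ** Hess f x)" for x
  have "G z = H" using HQ QH by (simp add: G_def flip: H_def)
  have "continuous_on X G"
    unfolding G_def matrix_matrix_mult_def
    by (intro continuous_intros continuous_on_vec_lambda continuous_on_component continuous_on_Hess[OF sm])
  moreover have "G x \<in> Sym2" if "x \<in> X" for x
  proof -
    have "transpose (Hess f x ** Q) = Q ** Hess f x" "transpose (Q ** Hess f x) = Hess f x ** Q"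
      using Sym2D[OF symH[OF that]] Q(1) by (simp_all add: matrix_transpose_mul)
    then show ?thesis
      by (simp add: Sym2_def G_def transpose_def vec_eq_iff)
  qed
  moreover have "G z \<in> (top_of_set Sym2) interior_of P"
    using int[OF X(2)] \<open>G z = H\<close> by (simp add: H_def)
  ultimately obtain S where S: "open S" "z \<in> S" "S \<subseteq> X" "\<And>x. x \<in> S \<Longrightarrow> G x \<in> (top_of_set Sym2) interior_of P"
    using interior_of_Sym2_stable_under_continuity[OF X] by metis
  define \<phi> where "\<phi> x = x + - (Q *v x) + Q *v grad f x" for x
  have smS: "smooth_on S f" using sm S(3) smooth_on_mono by blast
  have sm\<phi>: "smooth_on S \<phi>"
    unfolding \<phi>_def[abs_def]
    by (intro smooth_on_add smooth_on_id smooth_on_bounded_linear[OF S(1) matrix_vector_mul_bounded_linear]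
        smooth_on_bounded_linear[OF S(1) bounded_linear_minus[OF bounded_linear_ident]] smooth_on_grad smS S(1))
  have D\<phi>: "(\<phi> has_derivative (\<lambda>v. v + - (Q *v v) + Q *v (Hess f x *v v))) (at x)" if "x \<in> S" for x
    unfolding \<phi>_def[abs_def]
    by (intro has_derivative_add has_derivative_minus has_derivative_ident
        bounded_linear.has_derivative[OF matrix_vector_mul_bounded_linear] grad_has_derivative[OF S(1) that smS])
  have "inj (frechet_derivative \<phi> (at z))"
  proof -
    have "v = 0" if "v + - (Q *v v) + Q *v (H *v v) = 0" for v
    proof -
      have QHv: "Q *v (H *v v) = H *v v" by (simp add: matrix_vector_mul_assoc QH)
      have "Q *v (v + - (Q *v v) + Q *v (H *v v)) = H *v v"
        by (simp add: matrix_vector_right_distrib matrix_vector_mult_diff_distrib QQ QHv)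
      with that have "H *v v = 0" by simp
      then have "Q *v v = 0" using Q(3) by (simp add: L_def)
      with that \<open>H *v v = 0\<close> show "v = 0" by simp
    qed
    then have zero: "\<forall>v. v + - (Q *v v) + Q *v (H *v v) = 0 \<longrightarrow> v = 0" by blast
    have lin: "linear (\<lambda>v. v + - (Q *v v) + Q *v (H *v v))"
      using has_derivative_linear[OF D\<phi>[OF S(2)]] by (simp only: H_def)
    show ?thesis
      unfolding frechet_derivative_eqI[OF D\<phi>[OF S(2)]] H_def[symmetric] linear_injective_0[OF lin]
      by (rule zero)
  qed
  from smooth_inverse_function_theorem[OF S(1,2) sm\<phi> this]
  obtain U V \<psi> where U: "z \<in> U" "U \<subseteq> S" and diffeo: "diffeomorphism U V \<phi> \<psi>" by blast
  have "open U" using diffeo by (simp add: diffeomorphism_def)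
  have inv: "\<And>y. y \<in> U \<Longrightarrow> \<psi> (\<phi> y) = y" "\<And>y. y \<in> V \<Longrightarrow> \<phi> (\<psi> y) = y"
      "\<And>y. y \<in> U \<Longrightarrow> \<phi> y \<in> V" "\<And>y. y \<in> V \<Longrightarrow> \<psi> y \<in> U"
    using diffeo unfolding diffeomorphism_def homeomorphism_def by auto
  define M where "M = {x \<in> U. Q *v grad f x = 0}"
  have inL: "\<phi> x \<in> L \<longleftrightarrow> Q *v grad f x = 0" for x
  proof -
    have "Q *v \<phi> x = Q *v grad f x"
      unfolding \<phi>_def by (simp add: matrix_vector_right_distrib matrix_vector_mult_diff_distrib QQ)
    then show ?thesis using Q(3) by metis
  qed
  have slice: "\<phi> ` (M \<inter> U) = V \<inter> L"
  proof
    show "\<phi> ` (M \<inter> U) \<subseteq> V \<inter> L"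
      using inL inv(3) by (auto simp: M_def)
    show "V \<inter> L \<subseteq> \<phi> ` (M \<inter> U)"
    proof
      fix y assume y: "y \<in> V \<inter> L"
      then have "\<phi> (\<psi> y) = y" "\<psi> y \<in> U" using inv(2,4) by auto
      moreover have "\<psi> y \<in> M" using y calculation inL[of "\<psi> y"] by (simp add: M_def)
      ultimately show "y \<in> \<phi> ` (M \<inter> U)" by (metis IntI image_eqI)
    qed
  qed
  have smU: "smooth_on U f" using smS U(2) smooth_on_mono by blast
  have "continuous_on U (\<lambda>x. Q *v grad f x)"
    by (rule smooth_on_continuous_on[OF smooth_on_bounded_linear[OF \<open>open U\<close> matrix_vector_mul_bounded_linear
            smooth_on_grad[OF \<open>open U\<close> smU]]])
  then have "closedin (top_of_set U) M"
    unfolding M_def by (rule continuous_closedin_preimage_constant)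
  then have "closed_submanifold (dim L) U M"
    unfolding closed_submanifold_def using slice diffeo L by (fastforce simp: M_def)
  moreover have "free_subspace P (tangent_space M x)" if "x \<in> M" for x
    unfolding free_subspace_def
  proof
    have xU: "x \<in> U" using that by (simp add: M_def)
    then have xS: "x \<in> S" using U(2) by blast
    have T: "tangent_space M x = {v. dderiv \<phi> v x \<in> L}"
      by (rule tangent_space_slice_chart[OF diffeo L slice that xU])
    then have T2: "tangent_space M x = {v. Q *v (Hess f x *v v) = 0}"
      unfolding frechet_derivative_eqI[OF D\<phi>[OF xS]] Q(3)[symmetric]
      by (simp add: matrix_vector_right_distrib matrix_vector_mult_diff_distrib QQ)
    show "subspace (tangent_space M x)"
      unfolding T2 by (simp add: subspace_def matrix_vector_right_distrib matrix_vector_mult_scaleR)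
    have "A = 0" if A: "A \<in> polar P \<inter> Sym2_sub (tangent_space M x)" for A
    proof (rule polar_zero_on_interior[OF P])
      show "A \<in> polar P" using A by simp
      show "G x \<in> (top_of_set Sym2) interior_of P" by (rule S(4)[OF xS])
      have AS: "A \<in> Sym2" using A by (simp add: polar_def)
      have tH: "transpose (Hess f x) = Hess f x" using symH S(3) xS Sym2D by blast
      have "A *v (Hess f x *v (Q *v y)) = 0" for y
      proof -
        have "(Hess f x *v (Q *v y)) \<bullet> v = y \<bullet> (Q *v (Hess f x *v v))" for v
          using Q(1) tH by (metis dot_lmul_matrix transpose_matrix_vector)
        then have "Hess f x *v (Q *v y) \<in> (tangent_space M x)\<^sup>\<bottom>"
          unfolding orthogonal_comp_def orthogonal_def T2 by (simp add: inner_commute)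
        then show ?thesis using A by (simp add: Sym2_sub_def)
      qed
      then have "A ** (Hess f x ** Q) = 0"
        by (simp add: matrix_eq matrix_vector_mul_assoc[symmetric])
      then have tr: "trace (A ** (Hess f x ** Q)) = 0"
        by (simp add: trace_0[unfolded mat_0])
      have "trace (A ** (Q ** Hess f x)) = trace (transpose (A ** (Q ** Hess f x)))"
        by (simp add: trace_def transpose_def)
      also have "transpose (A ** (Q ** Hess f x)) = (Hess f x ** Q) ** A"
        using AS tH Q(1) by (simp add: matrix_transpose_mul Sym2D)
      also have "trace \<dots> = trace (A ** (Hess f x ** Q))" by (rule trace_mul_sym)
      finally have "trace (A ** (Q ** Hess f x)) = 0" using tr by simp
      with tr show "A \<bullet> G x = 0"
        by (simp add: G_def inner_add_right trace_mult_eq_inner[OF AS])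
    qed
    then show "polar P \<inter> Sym2_sub (tangent_space M x) = {0}"
      using zero_in_polar_Sym2_sub by blast
  qed
  moreover have "{x \<in> U. f x = 0} \<subseteq> M"
  proof
    fix x assume x: "x \<in> {x \<in> U. f x = 0}"
    have "grad f x = 0"
      by (rule grad_zero_at_minimum[OF X(1) _ sm]) (use x U(2) S(3) nonneg in auto)
    then show "x \<in> M" using x by (simp add: M_def)
  qed
  ultimately show ?thesis
    using that[of U M] \<open>open U\<close> U S(3) unfolding free_closed_submanifold_def by blast
qed

section \<open>Subsets of free submanifolds are zero sets\<close>

text \<open>Here \<open>f = |\<Phi>|\<^sup>2\<close> with \<open>\<Phi> = (Q \<phi>, w)\<close>. If a form \<open>A\<close> in the polar is orthogonal to the Hessian at \<open>z\<close>,
it kills all gradients of components of \<open>\<Phi>\<close>; by symmetry its range lies in the kernel of the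
derivative of \<open>\<Phi>\<close>, hence in the tangent space of \<open>M\<close>. So \<open>A\<close> is carried by the tangent space, and
freeness gives \<open>A = 0\<close>.\<close>

lemma subset_of_free_submanifold_locally_zero_set:
  fixes P :: "(real^'n::finite^'n) set"
  assumes P: "P \<subseteq> Sym2" "closed P" "convex P" "cone P" "positivity_condition P"
    and M: "free_closed_submanifold P X M" and z: "z \<in> M" "z \<notin> W" and W: "open W"
  obtains U f where "open U" "z \<in> U" "U \<subseteq> X" "strictly_psh_on P U f" "\<And>x. 0 \<le> f x"
    "\<And>x. x \<in> U \<Longrightarrow> f x = 0 \<longleftrightarrow> x \<in> M \<and> x \<notin> W"
proof -
  \<comment> \<open>If \<open>P\<close> were empty, its polar would consist of all symmetric matrices, negative ones included.\<close>
  have "P \<noteq> {}"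
  proof
    assume "P = {}"
    then have "Sym2 \<subseteq> (psd_cone :: (real^'n^'n) set)"
      using P(5) by (simp add: positivity_condition_def polar_def)
    moreover have "mat (-1) \<in> (Sym2 :: (real^'n^'n) set)"
      by (simp add: Sym2_def transpose_mat)
    ultimately have "mat (-1) \<in> (psd_cone :: (real^'n^'n) set)" by blast
    then have "0 \<le> axis i (1::real) \<bullet> (mat (-1) *v axis i 1)" for i :: 'n
      by (simp add: psd_cone_def)
    moreover have "mat (-1) *v x = - x" for x :: "real^'n"
      by (simp add: vec_eq_iff matrix_vector_mult_def mat_def if_distrib[where f = "\<lambda>c. c * _"] cong: if_cong)
    ultimately show False by (simp add: inner_axis_axis)
  qed
  obtain U V \<phi> \<psi> L where ch: "z \<in> U" "U \<subseteq> X" "diffeomorphism U V \<phi> \<psi>" "subspace L" "\<phi> ` (M \<inter> U) = V \<inter> L"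
    using M z(1) unfolding free_closed_submanifold_def closed_submanifold_def by metis
  have U: "open U" and sm\<phi>: "smooth_on U \<phi>" 
    and inv: "\<And>y. y \<in> U \<Longrightarrow> \<psi> (\<phi> y) = y" "\<And>y. y \<in> U \<Longrightarrow> \<phi> y \<in> V"
    using ch(3) unfolding diffeomorphism_def homeomorphism_def by auto
  have T: "tangent_space M z = {v. dderiv \<phi> v z \<in> L}"
    by (rule tangent_space_slice_chart[OF ch(3-5) z(1) ch(1)])
  obtain Q :: "real^'n^'n" where Q: "\<And>y. Q *v y = 0 \<longleftrightarrow> y \<in> L"
    by (rule orthogonal_projection_matrix_exists[OF ch(4)]) blast
  have inM: "x \<in> M \<longleftrightarrow> Q *v \<phi> x = 0" if "x \<in> U" for x
  proof
    assume "x \<in> M"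
    then have "\<phi> x \<in> V \<inter> L" using that ch(5) by blast
    then show "Q *v \<phi> x = 0" using Q by simp
  next
    assume "Q *v \<phi> x = 0"
    then have "\<phi> x \<in> V \<inter> L" using that inv(2) Q by simp
    then obtain y where "y \<in> M" "y \<in> U" "\<phi> x = \<phi> y" using ch(5) by blast
    then show "x \<in> M" using inv(1) that by metis
  qed
  obtain w :: "real^'n \<Rightarrow> real" where w: "smooth_on UNIV w" "\<And>x. x \<in> W \<Longrightarrow> w x > 0" "\<And>x. x \<notin> W \<Longrightarrow> w x = 0"
    using smooth_function_positive_exactly_on_open_set[OF W] by blast
  have smw: "smooth_on U w" by (rule smooth_on_mono[OF w(1)]) simp
  define \<Phi> where "\<Phi> x = (Q *v \<phi> x, w x)" for x
  have "smooth_on U (\<lambda>x. (Q *v \<phi> x, 0) + (0, w x))"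
    by (intro smooth_on_add U smooth_on_bounded_linear[OF U _ smw]
        smooth_on_bounded_linear[OF U _ sm\<phi>, where h = "\<lambda>v. (Q *v v, 0)"]
        bounded_linear_Pair bounded_linear_zero bounded_linear_ident matrix_vector_mul_bounded_linear)
  then have sm\<Phi>: "smooth_on U \<Phi>" by (simp add: \<Phi>_def[abs_def])
  define f where "f x = \<Phi> x \<bullet> \<Phi> x" for x
  have smf: "smooth_on U f"
    unfolding f_def[abs_def] by (rule smooth_on_bilinear[OF U bounded_bilinear_inner sm\<Phi> sm\<Phi>])
  have "\<Phi> z = 0" using inM[OF ch(1)] z w(3) by (simp add: \<Phi>_def zero_prod_def)
  have D\<Phi>: "dderiv \<Phi> v z = (Q *v dderiv \<phi> v z, dderiv w v z)" for v
    unfolding \<Phi>_def[abs_def]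
    using frechet_derivative_eqI[OF has_derivative_Pair[OF
        bounded_linear.has_derivative[OF matrix_vector_mul_bounded_linear smooth_on_has_derivative[OF sm\<phi> ch(1)]]
        smooth_on_has_derivative[OF smw ch(1)]], of Q] by simp
  have "Hess f z \<in> (top_of_set Sym2) interior_of P"
  proof (rule interior_of_cone_if_positive_on_polar[OF P(1-4) \<open>P \<noteq> {}\<close> Hess_in_Sym2[OF U ch(1) smf]])
    fix A assume A: "A \<in> polar P" "A \<noteq> 0"
    then have psd: "A \<in> psd_cone" and AS: "A \<in> Sym2"
      using P(5) by (auto simp: positivity_condition_def polar_def)
    define r where "r b = (\<chi> i. dderiv \<Phi> (axis i 1) z \<bullet> b)" for b
    have eq: "A \<bullet> Hess f z = 2 * (\<Sum>b\<in>Basis. r b \<bullet> (A *v r b))"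
      unfolding f_def[abs_def] r_def by (rule inner_Hess_inner_self_at_zero[OF U ch(1) sm\<Phi> \<open>\<Phi> z = 0\<close>])
    have nn: "0 \<le> r b \<bullet> (A *v r b)" for b
      using psd by (simp add: psd_cone_def)
    have "A \<bullet> Hess f z \<noteq> 0"
    proof
      assume "A \<bullet> Hess f z = 0"
      then have "r b \<bullet> (A *v r b) = 0" if "b \<in> Basis" for b
        using that nn by (simp add: eq sum_nonneg_eq_0_iff)
      then have Ar: "A *v r b = 0" if "b \<in> Basis" for b
        using psd_vanishes_on_isotropic[OF psd] that by blast
      have "A *v u \<in> tangent_space M z" for u
      proof -
        have b0: "dderiv \<Phi> (A *v u) z \<bullet> b = 0" if "b \<in> Basis" for b
        proof -
          have "dderiv \<Phi> (A *v u) z \<bullet> b = (A *v u) \<bullet> r b"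
            unfolding dderiv_axis_sum[OF smooth_on_differentiable[OF sm\<Phi> ch(1)], of "A *v u"]
            by (simp add: inner_sum_left r_def inner_vec_def)
          also have "\<dots> = u \<bullet> (A *v r b)" by (rule Sym2_inner_matrix_vector[OF AS])
          finally show ?thesis using Ar[OF that] by simp
        qed
        have "dderiv \<Phi> (A *v u) z = 0"
          by (rule euclidean_eqI) (simp only: b0 inner_zero_left)
        then show ?thesis using T Q by (simp add: D\<Phi> zero_prod_def)
      qed
      then have "A *v v = 0" if "v \<in> (tangent_space M z)\<^sup>\<bottom>" for v
      proof -
        have "(A *v v) \<bullet> u = 0" for u
        proof -
          have "(A *v u) \<bullet> v = 0"
            using that \<open>A *v u \<in> tangent_space M z\<close> by (simp add: orthogonal_comp_def orthogonal_def)
          then show ?thesis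
            using Sym2_inner_matrix_vector[OF AS, of v u] by (simp add: inner_commute)
        qed
        then show ?thesis by (metis inner_eq_zero_iff)
      qed
      then have "A \<in> polar P \<inter> Sym2_sub (tangent_space M z)"
        using A AS by (simp add: Sym2_sub_def)
      then show False
        using M z(1) A(2) by (auto simp: free_closed_submanifold_def free_subspace_def)
    qed
    moreover have "0 \<le> A \<bullet> Hess f z" unfolding eq by (simp add: sum_nonneg nn)
    ultimately show "0 < A \<bullet> Hess f z" by simp
  qed
  then obtain S where S: "open S" "z \<in> S" "S \<subseteq> U" "\<And>x. x \<in> S \<Longrightarrow> Hess f x \<in> (top_of_set Sym2) interior_of P"
    using interior_of_Sym2_stable_under_continuity[OF U ch(1) continuous_on_Hess[OF smf] Hess_in_Sym2[OF U _ smf]] by metis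
  show ?thesis
  proof (rule that[OF S(1,2)])
    show "S \<subseteq> X" using S(3) ch(2) by blast
    show "strictly_psh_on P S f"
      using S(3,4) smooth_on_mono[OF smf] by (simp add: strictly_psh_on_def)
    show "0 \<le> f x" for x by (simp add: f_def)
    show "f x = 0 \<longleftrightarrow> x \<in> M \<and> x \<notin> W" if "x \<in> S" for x
    proof -
      have "f x = 0 \<longleftrightarrow> \<Phi> x = 0" by (simp add: f_def)
      also have "\<dots> \<longleftrightarrow> Q *v \<phi> x = 0 \<and> w x = 0" by (simp add: \<Phi>_def zero_prod_def)
      finally show ?thesis
        using inM[of x] that S(3) w(2,3)[of x] by force
    qed
  qed
qed

section \<open>The two local classes agree\<close>

lemma closedin_Int_open_subset:
  assumes "closedin (top_of_set X) Z" "U \<subseteq> X"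
  shows "closedin (top_of_set U) (Z \<inter> U)"
  using assms by (auto simp: closedin_closed)

theorem theorem11p3:
  fixes P :: "(real^'n::finite^'n) set" and X Z :: "(real^'n) set"
  assumes "P \<subseteq> Sym2" and "closed P" and "convex P" and "cone P"
    and "positivity_condition P"
    and "open X" and "closedin (top_of_set X) Z"
  shows "(\<forall>z\<in>Z. \<exists>U. open U \<and> z \<in> U \<and> U \<subseteq> X \<and> subset_of_free_submanifold P U (Z \<inter> U)) \<longleftrightarrow>
         (\<forall>z\<in>Z. \<exists>U. open U \<and> z \<in> U \<and> U \<subseteq> X \<and> zero_set_of_strictly_psh P U (Z \<inter> U))"
proof (intro iffI ballI)
  fix z assume "\<forall>z\<in>Z. \<exists>U. open U \<and> z \<in> U \<and> U \<subseteq> X \<and> subset_of_free_submanifold P U (Z \<inter> U)" and z: "z \<in> Z"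
  then obtain U M where U: "open U" "z \<in> U" "U \<subseteq> X" "closedin (top_of_set U) (Z \<inter> U)"
    and M: "free_closed_submanifold P U M" "Z \<inter> U \<subseteq> M"
    unfolding subset_of_free_submanifold_def by metis
  have "open (U - Z)"
  proof -
    have "U - Z = U - Z \<inter> U" by blast
    then show ?thesis
      using openin_diff[OF openin_subtopology_self U(4)] openin_open_trans[OF _ U(1)] by simp
  qed
  moreover have "z \<in> M" "z \<notin> U - Z" using z U(2) M(2) by auto
  ultimately obtain U' f where "open U'" "z \<in> U'" "U' \<subseteq> U" "strictly_psh_on P U' f" "\<And>x. 0 \<le> f x"
    and f0: "\<And>x. x \<in> U' \<Longrightarrow> f x = 0 \<longleftrightarrow> x \<in> M \<and> x \<notin> U - Z"
    using subset_of_free_submanifold_locally_zero_set[OF assms(1-5) M(1)] by metis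
  moreover have "Z \<inter> U' = {x \<in> U'. f x = 0}"
    using f0 \<open>U' \<subseteq> U\<close> M(2) by blast
  ultimately show "\<exists>U. open U \<and> z \<in> U \<and> U \<subseteq> X \<and> zero_set_of_strictly_psh P U (Z \<inter> U)"
    using U(3) unfolding zero_set_of_strictly_psh_def by blast
next
  fix z assume "\<forall>z\<in>Z. \<exists>U. open U \<and> z \<in> U \<and> U \<subseteq> X \<and> zero_set_of_strictly_psh P U (Z \<inter> U)" and z: "z \<in> Z"
  then obtain U where U: "open U" "z \<in> U" "U \<subseteq> X" and "zero_set_of_strictly_psh P U (Z \<inter> U)"
    by blast
  then obtain f where f: "strictly_psh_on P U f" "\<forall>x\<in>U. 0 \<le> f x" "Z \<inter> U = {x \<in> U. f x = 0}"
    unfolding zero_set_of_strictly_psh_def by blast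
  have "f z = 0" using f(3) z U(2) by blast
  obtain U' M where U': "open U'" "z \<in> U'" "U' \<subseteq> U" and M: "free_closed_submanifold P U' M" "{x \<in> U'. f x = 0} \<subseteq> M"
    using zero_set_locally_in_free_submanifold[OF assms(1) U(1,2) f(1) _ \<open>f z = 0\<close>] f(2) by blast
  have "Z \<inter> U' \<subseteq> M" using M(2) f(3) U'(3) by blast
  moreover have "closedin (top_of_set U') (Z \<inter> U')"
    using closedin_Int_open_subset[OF assms(7)] U(3) U'(3) by blast
  ultimately show "\<exists>U. open U \<and> z \<in> U \<and> U \<subseteq> X \<and> subset_of_free_submanifold P U (Z \<inter> U)"
    unfolding subset_of_free_submanifold_def using U' U(3) M(1) by blast
qed

end
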